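(* Let $\lambda,\gamma\in\mathbb{C}$. The Gegenbauer generating function $$\sum_{n=0}^\infty \frac{(\gamma)_n}{(2\lambda)_n}\,C_n^\lambda(x)\,t^n$$ is algebraic (1) if $\lambda\in\mathbb{Z}\pm\frac14$ with $\gamma-\lambda\in\mathbb{Z}\pm\frac13$; or (2) if $\lambda\in\mathbb{Z}\pm\frac16$ with $\gamma-\lambda\in\mathbb{Z}\pm\{\frac13,\frac14\}$.
   Context: For $\lambda\in\mathbb{C}$ the Gegenbauer polynomials $C_n^\lambda(x)$, $n=0,1,2,\dots$, are defined by $\sum_{n=0}^\infty C_n^\lambda(x)t^n=(1-2xt+t^2)^{-\lambda}$ (as a power series in $t$ with constant term $1$). $(a)_n=a(a+1)\cdots(a+n-1)$ is the Pochhammer symbol. The notation $\mathbb{Z}\pm a$ means the set of all numbers differing from an integer by $a$ or $-a$, and $\mathbb{Z}\pm\{a,b\}=(\mathbb{Z}\pm a)\cup(\mathbb{Z}\pm b)$; all sign choices are independent. "Algebraic" means that the power series in $t$ defines an algebraic function of its arguments $t,x$. *)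

theory Defs
  imports "HOL-Analysis.FPS_Convergence"
begin

text \<open>
  The power series with constant term 1 of \<open>f\<^sup>c\<close>, for \<open>f\<close> with constant term 1:
  substitute \<open>f - 1\<close> for \<open>X\<close> in the binomial series \<open>(1 + X)\<^sup>c\<close>.
\<close>
definition fps_cpow :: "complex fps \<Rightarrow> complex \<Rightarrow> complex fps" where
  "fps_cpow f c = fps_binomial c oo (f - 1)"

definition gegenbauer :: "nat \<Rightarrow> complex \<Rightarrow> complex \<Rightarrow> complex" where
  "gegenbauer n lam x =
     fps_nth (fps_cpow (1 - fps_const (2 * x) * fps_X + fps_X ^ 2) (- lam)) n"

text \<open>
  For each fixed \<open>x\<close>, a power series in \<open>t\<close>.  Where \<open>pochhammer (2 * lam) n = 0\<close>, i.e. for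
  \<open>2 * lam\<close> a non-positive integer greater than \<open>- n\<close>, the coefficient is 0 by the convention on
  division by zero.
\<close>
definition gegenbauer_gf :: "complex \<Rightarrow> complex \<Rightarrow> complex \<Rightarrow> complex fps" where
  "gegenbauer_gf \<gamma> lam x =
     Abs_fps (\<lambda>n. pochhammer \<gamma> n / pochhammer (2 * lam) n * gegenbauer n lam x)"

text \<open>
  A polynomial in three variables is represented as \<open>P \<in> \<complex>[x][t][y]\<close>: the outermost variable
  is \<open>y\<close>, the innermost is \<open>x\<close>.
\<close>
definition poly3 :: "complex poly poly poly \<Rightarrow> complex \<Rightarrow> complex \<Rightarrow> complex \<Rightarrow> complex" where
  "poly3 P x t y = poly (poly (poly P [:[:y:]:]) [:t:]) x"

text \<open>
  The family \<open>F x\<close> of power series in \<open>t\<close> defines a function of \<open>(x, t)\<close> (each series has a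
  positive radius of convergence), and this function is algebraic over \<open>\<complex>(x, t)\<close>.  The
  polynomial \<open>P\<close> is the same for all \<open>x\<close> and \<open>t\<close>.  It necessarily involves \<open>y\<close>, since a nonzero
  polynomial in \<open>x\<close> and \<open>t\<close> alone cannot vanish on a disc in \<open>t\<close> for every \<open>x\<close>.
\<close>
definition defines_algebraic_function :: "(complex \<Rightarrow> complex fps) \<Rightarrow> bool" where
  "defines_algebraic_function F \<longleftrightarrow>
     (\<forall>x. fps_conv_radius (F x) > 0) \<and>
     (\<exists>P. P \<noteq> 0 \<and>
        (\<forall>x t. ereal (norm t) < fps_conv_radius (F x) \<longrightarrow>
           poly3 P x t (eval_fps (F x) t) = 0))"

definition Ints_pm :: "complex \<Rightarrow> complex set" where
  "Ints_pm a = {z. \<exists>m::int. z = of_int m + a \<or> z = of_int m - a}"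

end

theory Submission
  imports Defs "HOL-Complex_Analysis.Laurent_Convergence"
begin

text \<open>
  Write \<open>F\<close> for the generating function.  Expanding in powers of \<open>x\<^sup>2 - 1\<close> identifies it with
  a hypergeometric series (\<open>gegenbauer_gf_eq\<close>):

    \<open>F = (1 - x t)^(-\<gamma>) \<cdot> \<Phi>(\<zeta>)\<close>, where \<open>\<zeta> = (x\<^sup>2 - 1) t\<^sup>2 / (1 - x t)\<^sup>2\<close> and
    \<open>\<Phi> = 2F1(\<gamma>/2, \<gamma>/2 + 1/2; \<lambda> + 1/2)\<close>.

  The hypergeometric equation of \<open>\<Phi>\<close> has exponent differences \<open>1/2 - \<lambda>\<close>, \<open>\<lambda> - \<gamma>\<close>, \<open>1/2\<close> at
  \<open>0\<close>, \<open>1\<close>, \<open>\<infinity>\<close>.  Up to signs and integers, the hypotheses say that these are \<open>(1/4, 1/3, 1/2)\<close>,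
  \<open>(1/3, 1/3, 1/2)\<close> or \<open>(1/3, 1/4, 1/2)\<close>: the octahedral and tetrahedral entries of Schwarz's
  list.  When the differences are exactly these, a suitable quotient of two solutions is inverse to the
  map that divides the Riemann sphere by the rotation group of an octahedron or a tetrahedron.  A power of this quotient is a coordinate
  \<open>s\<close> in which the independent variable of \<open>\<Phi>\<close> becomes a rational function
  \<open>k s A(s)^(m+1) / E(s)\<^sup>2\<close>, and in which \<open>\<Phi>\<close> is elementary.  The proof has three steps.

  \<^item> For each of the three maps and each of the four classes of \<open>(\<lambda>, \<gamma>)\<close> modulo integers, one
    representative satisfies \<open>\<Phi> = E^\<gamma> / (A^\<alpha> B^\<beta>)\<close> with \<open>\<alpha>\<close>, \<open>\<beta>\<close> in \<open>{0, 1}\<close>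
    (\<open>hypergeo_along_cover\<close>).  Such a formula amounts to one polynomial identity in \<open>s\<close>.

  \<^item> First-order contiguity operators shift \<open>\<gamma>\<close> and \<open>\<lambda>\<close> by integers.  They preserve the series
    that become \<open>E^\<gamma>\<^sub>0\<close> times a rational function of \<open>s\<close>, with \<open>\<gamma>\<^sub>0\<close> the value of \<open>\<gamma>\<close> at the
    representative (\<open>uniformized_shift\<close>), because \<open>d/dz\<close> is \<open>d/ds\<close> divided by a rational function.

  \<^item> At \<open>z = \<zeta>(x, t)\<close> the coordinate \<open>s\<close> is a root of a polynomial over \<open>\<complex>[x, t]\<close>, and \<open>F^12\<close> is
    a rational function of \<open>x\<close>, \<open>t\<close> and \<open>s\<close>, because \<open>12 \<gamma>\<close> is an integer.  Eliminating \<open>s\<close> by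
    linear algebra gives a polynomial for \<open>F\<close> that is the same for all \<open>x\<close>
    (\<open>elimination\<close>, \<open>uniformized_imp_algebraic\<close>).

  All identities are proved between formal power series.  Convergence enters only in the positive
  radius of \<open>F\<close> (\<open>fps_conv_radius_gegenbauer_gf\<close>) and in the evaluation of the polynomial relation
  at complex numbers (\<open>defines_algebraic_functionI\<close>).
\<close>

unbundle no vec_syntax
unbundle fps_syntax

section \<open>Complex powers of power series\<close>

lemma fps_cpow_nth_0 [simp]: "fps_cpow f c $ 0 = 1"
  by (simp add: fps_cpow_def)

lemma fps_cpow_add: "f $ 0 = 1 \<Longrightarrow> fps_cpow f (a + b) = fps_cpow f a * fps_cpow f b"
  by (simp add: fps_cpow_def fps_binomial_add_mult fps_compose_mult_distrib)

lemma fps_cpow_of_nat: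
  assumes "f $ 0 = 1" shows "fps_cpow f (of_nat n) = f ^ n"
proof -
  have "fps_cpow f (of_nat n) = ((1 + fps_X) oo (f - 1)) ^ n"
    using assms by (simp add: fps_cpow_def fps_binomial_of_nat fps_compose_power)
  also have "(1 + fps_X) oo (f - 1) = f"
    using assms by (simp add: fps_compose_add_distrib fps_X_fps_compose_startby0)
  finally show ?thesis .
qed

lemma fps_cpow_power:
  "f $ 0 = 1 \<Longrightarrow> fps_cpow f c ^ n = fps_cpow f (of_nat n * c)"
  by (simp add: fps_cpow_def fps_compose_power fps_binomial_power)

lemma fps_cpow_minus:
  assumes "f $ 0 = 1" shows "fps_cpow f c * fps_cpow f (- c) = 1"
  using fps_cpow_add[OF assms, of c "-c"] fps_cpow_of_nat[OF assms, of 0] by simp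

lemma fps_cpow_deriv:
  assumes "f $ 0 = 1"
  shows "f * fps_deriv (fps_cpow f c) = fps_const c * fps_deriv f * fps_cpow f c"
proof -
  have "(1 + fps_X) * fps_deriv (fps_binomial c) = fps_const c * fps_binomial c"
    by (simp add: fps_binomial_deriv fps_divide_unit inverse_mult_eq_1' mult.left_commute)
  hence "((1 + fps_X) * fps_deriv (fps_binomial c)) oo (f - 1) = (fps_const c * fps_binomial c) oo (f - 1)"
    by simp
  hence "f * (fps_deriv (fps_binomial c) oo (f - 1)) = fps_const c * fps_cpow f c"
    using assms by (simp add: fps_compose_mult_distrib fps_cpow_def fps_compose_add_distrib
        fps_X_fps_compose_startby0)
  thus ?thesis using assms
    by (simp add: fps_cpow_def fps_compose_deriv mult_ac)
qed

lemma fps_cpow_compose: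
  assumes "f $ 0 = 1" "g $ 0 = 0"
  shows "fps_cpow f c oo g = fps_cpow (f oo g) c"
  using assms by (simp add: fps_cpow_def fps_compose_sub_distrib
      flip: fps_compose_assoc)

text \<open>
  Up to the constant term, a power is determined by its logarithmic derivative, and logarithmic
  derivatives of products add up.
\<close>
lemma fps_cpow_mult:
  assumes f: "f $ 0 = 1" and g: "g $ 0 = 1"
  shows "fps_cpow (f * g) c = fps_cpow f c * fps_cpow g c"
proof -
  define u v h where "u = fps_cpow f c" and "v = fps_cpow g c" and "h = fps_cpow (f * g) (- c)"
  have fg: "(f * g) $ 0 = 1" using f g by simp
  have d: "f * fps_deriv u = fps_const c * fps_deriv f * u"
    "g * fps_deriv v = fps_const c * fps_deriv g * v"
    "f * g * fps_deriv h = fps_const (- c) * fps_deriv (f * g) * h"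
    using fps_cpow_deriv[OF f, of c] fps_cpow_deriv[OF g, of c] fps_cpow_deriv[OF fg, of "-c"]
    unfolding u_def v_def h_def by (simp_all only: fps_const_neg)
  have "f * g * fps_deriv (u * v * h) =
      (f * fps_deriv u) * (g * v * h) + (g * fps_deriv v) * (f * u * h) + (f * g * fps_deriv h) * (u * v)"
    by (simp add: algebra_simps)
  also have "\<dots> = 0"
    unfolding d by (simp add: algebra_simps flip: fps_const_neg)
  finally have "fps_deriv (u * v * h) = 0"
    using f g by auto
  hence "u * v * h = fps_const ((u * v * h) $ 0)"
    by (metis fps_deriv_eq_0_iff)
  also have "(u * v * h) $ 0 = 1"
    by (simp add: u_def v_def h_def)
  finally have "u * v * (h * fps_cpow (f * g) c) = fps_cpow (f * g) c"
    by (simp add: mult.assoc[symmetric])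
  moreover have "h * fps_cpow (f * g) c = 1"
    using fps_cpow_minus[OF fg, of "-c"] by (simp add: h_def)
  ultimately show ?thesis by (simp add: u_def v_def)
qed

lemma fps_cpow_minus_of_nat:
  assumes "f $ 0 = 1" shows "fps_cpow f (- of_nat n) = inverse (f ^ n)"
  using fps_cpow_minus[OF assms, of "of_nat n"] fps_cpow_of_nat[OF assms, of n]
  by (metis fps_inverse_unique)

lemma fps_cpow_linear_nth:
  "fps_cpow (1 - fps_const x * fps_X) (- b) $ m = pochhammer b m / fact m * x ^ m"
proof -
  have "1 - fps_const x * fps_X - 1 = fps_const (- x) * fps_X"
    by (simp flip: fps_const_neg)
  hence "fps_cpow (1 - fps_const x * fps_X) (- b) = fps_binomial (- b) oo (fps_const (- x) * fps_X)"
    by (simp only: fps_cpow_def)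
  thus ?thesis
    by (simp only: fps_nth_compose_linear fps_binomial_nth gbinomial_pochhammer)
       (simp add: power_minus[of x])
qed

text \<open>
  Since \<open>g^k\<close> has no terms of degree below \<open>k\<close>, the inner sums can all be taken up to the same
  bound, which allows them to be interchanged with the convolution.
\<close>
lemma fps_mult_compose_nth:
  fixes u h g :: "complex fps"
  assumes "g $ 0 = 0"
  shows "(u * (h oo g)) $ n = (\<Sum>k\<le>n. h $ k * (u * g ^ k) $ n)"
proof -
  have "(h oo g) $ j = (\<Sum>k\<le>n. h $ k * (g ^ k) $ j)" if "j \<le> n" for j
    unfolding fps_compose_nth using that assms
    by (intro sum.mono_neutral_left) (auto simp: startsby_zero_power_prefix)
  hence "(u * (h oo g)) $ n = (\<Sum>i=0..n. \<Sum>k\<le>n. u $ i * (h $ k * (g ^ k) $ (n - i)))"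
    by (simp add: fps_mult_nth sum_distrib_left)
  also have "\<dots> = (\<Sum>k\<le>n. \<Sum>i=0..n. u $ i * (h $ k * (g ^ k) $ (n - i)))"
    by (rule sum.swap)
  also have "\<dots> = (\<Sum>k\<le>n. h $ k * (u * g ^ k) $ n)"
    by (simp add: fps_mult_nth sum_distrib_left mult_ac)
  finally show ?thesis .
qed

lemma fps_cpow_of_int:
  assumes "f $ 0 = 1"
  shows "fps_cpow f (of_int i) * f ^ nat (- i) = f ^ nat i"
proof -
  have "fps_cpow f (of_int i) * fps_cpow f (of_nat (nat (- i))) = fps_cpow f (of_int i + of_nat (nat (- i)))"
    by (rule fps_cpow_add[OF assms, symmetric])
  also have "of_int i + of_nat (nat (- i)) = (of_nat (nat i) :: complex)"
    by (cases "i \<ge> 0") (auto simp: of_nat_nat)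
  finally show ?thesis by (simp add: fps_cpow_of_nat[OF assms])
qed

section \<open>Hypergeometric series and their contiguous neighbours\<close>

definition hypergeo :: "complex \<Rightarrow> complex \<Rightarrow> complex \<Rightarrow> complex fps" where
  "hypergeo a b c =
     Abs_fps (\<lambda>n. pochhammer a n * pochhammer b n / (pochhammer c n * fact n))"

lemma hypergeo_commute: "hypergeo a b c = hypergeo b a c"
  by (simp add: hypergeo_def mult.commute)

lemma nonint_add_nat: "c \<notin> \<int> \<Longrightarrow> c + of_nat n \<noteq> (0::complex)"
  by (metis Ints_minus Ints_of_nat add_eq_0_iff2)

lemma nonint_pochhammer: "c \<notin> \<int> \<Longrightarrow> pochhammer c n \<noteq> (0::complex)"
  by (metis add.left_inverse nonint_add_nat pochhammer_eq_0_iff)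

lemma hypergeo_nth_Suc:
  assumes "c \<notin> \<int>"
  shows "hypergeo a b c $ Suc n =
    hypergeo a b c $ n * ((a + of_nat n) * (b + of_nat n) / ((c + of_nat n) * of_nat (Suc n)))"
  by (simp add: hypergeo_def pochhammer_Suc mult_ac)

lemma hypergeo_nth_0 [simp]: "hypergeo a b c $ 0 = 1"
  by (simp add: hypergeo_def)

text \<open>
  The next four lemmas are Gauss's contiguity relations in operator form.  They involve no division
  by a series, so any class of series that is closed under sums, derivatives and multiplication by the
  variable and by constants is closed under shifts of the parameters, as long as the constant on the
  right-hand side does not vanish.
\<close>
lemma hypergeo_raise:
  "fps_X * fps_deriv (hypergeo a b c) + fps_const a * hypergeo a b c = fps_const a * hypergeo (a + 1) b c"
proof (rule fps_ext)
  fix n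
  have "(a + of_nat n) * pochhammer a n = a * pochhammer (a + 1) n"
    by (metis pochhammer_Suc pochhammer_rec mult.commute)
  hence *: "of_nat n * pochhammer a n + a * pochhammer a n = a * pochhammer (a + 1) n"
    by (simp add: algebra_simps)
  have "(fps_X * fps_deriv (hypergeo a b c) + fps_const a * hypergeo a b c) $ n
     = (of_nat n * pochhammer a n + a * pochhammer a n) * (pochhammer b n / (pochhammer c n * fact n))"
    by (cases n) (simp_all add: hypergeo_def add_divide_distrib distrib_right mult.assoc)
  thus "(fps_X * fps_deriv (hypergeo a b c) + fps_const a * hypergeo a b c) $ n =
      (fps_const a * hypergeo (a + 1) b c) $ n"
    unfolding * by (simp add: hypergeo_def)
qed

lemma hypergeo_lower:
  assumes c: "c \<notin> \<int>"
  shows "fps_X * (1 - fps_X) * fps_deriv (hypergeo a b c) +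
      (fps_const (c - a) - fps_const b * fps_X) * hypergeo a b c
    = fps_const (c - a) * hypergeo (a - 1) b c"
proof (rule fps_ext)
  fix n
  define h where "h = hypergeo a b c"
  have L: "fps_X * (1 - fps_X) * fps_deriv h + (fps_const (c - a) - fps_const b * fps_X) * h
      = fps_X * fps_deriv h - fps_X * (fps_X * fps_deriv h) + fps_const (c - a) * h
        - fps_const b * (fps_X * h)"
    by (simp add: algebra_simps)
  show "(fps_X * (1 - fps_X) * fps_deriv (hypergeo a b c) +
      (fps_const (c - a) - fps_const b * fps_X) * hypergeo a b c) $ n
    = (fps_const (c - a) * hypergeo (a - 1) b c) $ n"
    unfolding h_def[symmetric] L
  proof (cases n)
    case (Suc m)
    have s: "h $ Suc m = h $ m * ((a + of_nat m) * (b + of_nat m) / ((c + of_nat m) * of_nat (Suc m)))"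
      unfolding h_def by (rule hypergeo_nth_Suc[OF c])
    have cm: "c + of_nat m \<noteq> 0" using c by (rule nonint_add_nat)
    have t: "hypergeo (a - 1) b c $ Suc m =
        h $ m * ((a - 1) * (b + of_nat m) / ((c + of_nat m) * of_nat (Suc m)))"
      by (simp add: hypergeo_def h_def pochhammer_rec[of "a - 1"] pochhammer_Suc[of b] pochhammer_Suc[of c] mult_ac)
    have x1: "(fps_X * fps_deriv h) $ Suc m = of_nat (Suc m) * h $ Suc m"
      and x2: "(fps_X * h) $ Suc m = h $ m"
      by simp_all
    have xx: "(fps_X * (fps_X * fps_deriv h)) $ Suc m = of_nat m * h $ m"
      by (cases m) simp_all
    define q q' where "q = (a + of_nat m) * (b + of_nat m) / ((c + of_nat m) * of_nat (Suc m))"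
      and "q' = (a - 1) * (b + of_nat m) / ((c + of_nat m) * of_nat (Suc m))"
    have "(of_nat (Suc m) + (c - a)) * ((a + of_nat m) * (b + of_nat m) / ((c + of_nat m) * of_nat (Suc m)))
       - (of_nat m + b) = (c - a) * ((a - 1) * (b + of_nat m) / ((c + of_nat m) * of_nat (Suc m)))"
      using cm by (simp add: divide_simps del: of_nat_Suc) (simp add: algebra_simps)
    hence "(of_nat (Suc m) + (c - a)) * q = of_nat m + b + (c - a) * q'"
      unfolding q_def q'_def by (simp only: diff_eq_eq add.commute)
    thus "(fps_X * fps_deriv h - fps_X * (fps_X * fps_deriv h) + fps_const (c - a) * h
        - fps_const b * (fps_X * h)) $ n = (fps_const (c - a) * hypergeo (a - 1) b c) $ n"
      unfolding Suc
      unfolding fps_add_nth fps_sub_nth fps_mult_left_const_nth xx t[folded q'_def] x1 x2 s[folded q_def]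
      by algebra
  qed (simp_all add: h_def)
qed

lemma hypergeo_raise_c:
  assumes c: "c \<notin> \<int>"
  shows "(1 - fps_X) * fps_deriv (hypergeo a b c) + fps_const (c - a - b) * hypergeo a b c
    = fps_const ((c - a) * (c - b) / c) * hypergeo a b (c + 1)"
proof (rule fps_ext)
  fix m
  define h where "h = hypergeo a b c"
  have L: "(1 - fps_X) * fps_deriv h = fps_deriv h - fps_X * fps_deriv h"
    by (simp add: algebra_simps)
  have xx: "(fps_X * fps_deriv h) $ m = of_nat m * h $ m" by (cases m) simp_all
  have s: "h $ Suc m = h $ m * ((a + of_nat m) * (b + of_nat m) / ((c + of_nat m) * of_nat (Suc m)))"
      unfolding h_def by (rule hypergeo_nth_Suc[OF c])
  have cm: "c + of_nat m \<noteq> 0" "c \<noteq> 0" using c nonint_add_nat[of c m] by auto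
  have p: "c * pochhammer (c + 1) m = (c + of_nat m) * pochhammer c m"
    by (metis pochhammer_Suc pochhammer_rec mult.commute)
  have t: "hypergeo a b (c + 1) $ m = h $ m * (c / (c + of_nat m))"
  proof -
    have "pochhammer (c + 1) m = (c + of_nat m) * pochhammer c m / c"
      using p cm by (simp add: field_simps)
    thus ?thesis using cm by (simp add: hypergeo_def h_def)
  qed
  define q q' where "q = (a + of_nat m) * (b + of_nat m) / ((c + of_nat m) * of_nat (Suc m))"
    and "q' = c / (c + of_nat m)"
  define r where "r = (c - a) * (c - b) / c"
  have "of_nat (Suc m) * ((a + of_nat m) * (b + of_nat m) / ((c + of_nat m) * of_nat (Suc m))) - of_nat m
     + (c - a - b) = (c - a) * (c - b) / c * (c / (c + of_nat m))"
    using cm by (simp add: divide_simps del: of_nat_Suc) (simp add: algebra_simps)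
  hence "of_nat (Suc m) * q - of_nat m + (c - a - b) = r * q'"
    unfolding q_def q'_def r_def .
  thus "((1 - fps_X) * fps_deriv (hypergeo a b c) + fps_const (c - a - b) * hypergeo a b c) $ m
    = (fps_const ((c - a) * (c - b) / c) * hypergeo a b (c + 1)) $ m"
    unfolding h_def[symmetric] L r_def[symmetric]
    unfolding fps_add_nth fps_sub_nth fps_mult_left_const_nth xx t[folded q'_def] fps_deriv_nth
      Suc_eq_plus1[symmetric] s[folded q_def]
    by algebra
qed

lemma hypergeo_lower_c:
  assumes c: "c \<notin> \<int>"
  shows "fps_X * fps_deriv (hypergeo a b c) + fps_const (c - 1) * hypergeo a b c
    = fps_const (c - 1) * hypergeo a b (c - 1)"
proof (rule fps_ext)
  fix m
  define h where "h = hypergeo a b c"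
  have xx: "(fps_X * fps_deriv h) $ m = of_nat m * h $ m" by (cases m) simp_all
  have c': "c - 1 \<notin> \<int>" using c by (metis Ints_1 Ints_diff Ints_minus diff_add_cancel Ints_add)
  have cm: "c + of_nat m \<noteq> 0" "c - 1 \<noteq> 0" using c c' nonint_add_nat[of c m] by auto
  have p: "(c - 1) * pochhammer c m = (c - 1 + of_nat m) * pochhammer (c - 1) m"
    using pochhammer_Suc[of "c - 1" m] pochhammer_rec[of "c - 1" m] by (simp add: mult.commute)
  have t: "(c - 1) * hypergeo a b (c - 1) $ m = h $ m * (c - 1 + of_nat m)"
  proof -
    have "pochhammer c m = (c - 1 + of_nat m) * pochhammer (c - 1) m / (c - 1)"
      using p cm by (simp add: field_simps)
    thus ?thesis using cm nonint_add_nat[OF c', of m] by (simp add: hypergeo_def h_def)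
  qed
  show "(fps_X * fps_deriv (hypergeo a b c) + fps_const (c - 1) * hypergeo a b c) $ m
    = (fps_const (c - 1) * hypergeo a b (c - 1)) $ m"
    unfolding h_def[symmetric] using t by (simp add: xx algebra_simps)
qed

text \<open>
  The second-order hypergeometric equation, written as a first-order system for
  \<open>y = 2F1(a, b; c)\<close> and \<open>z = 2F1(a + 1, b; c)\<close>: the equations are \<open>hypergeo_raise\<close> and, with \<open>a + 1\<close>
  for \<open>a\<close>, \<open>hypergeo_lower\<close>.  Verifying a closed form through this system requires only logarithmic
  derivatives.
\<close>
lemma hypergeo_unique:
  assumes c: "c \<notin> \<int>" and a: "a \<noteq> 0" and y0: "y $ 0 = 1"
    and 1: "fps_X * fps_deriv y = fps_const a * (z - y)"
    and 2: "fps_X * (1 - fps_X) * fps_deriv z =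
       fps_const (c - a - 1) * y - (fps_const (c - a - 1) - fps_const b * fps_X) * z"
  shows "y = hypergeo a b c"
proof (rule fps_ext)
  fix n show "y $ n = hypergeo a b c $ n"
  proof (induction n)
    case (Suc m)
    have z: "a * z $ n = (of_nat n + a) * y $ n" for n
    proof -
      have "(fps_X * fps_deriv y) $ n = of_nat n * y $ n" by (cases n) simp_all
      thus ?thesis using arg_cong[OF 1, of "\<lambda>f. f $ n"] by (simp add: algebra_simps)
    qed
    have cm: "c + of_nat m \<noteq> 0" using c by (rule nonint_add_nat)
    have xx: "(fps_X * (fps_X * fps_deriv z)) $ Suc m = of_nat m * z $ m"
      by (cases m) simp_all
    have "fps_X * fps_deriv z - fps_X * (fps_X * fps_deriv z) =
       fps_const (c - a - 1) * y - fps_const (c - a - 1) * z + fps_const b * (fps_X * z)"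
      using 2 by (simp add: algebra_simps)
    from arg_cong[OF this, of "\<lambda>f. f $ Suc m"]
    have "(of_nat (Suc m) + c - a - 1) * z $ Suc m = (c - a - 1) * y $ Suc m + (of_nat m + b) * z $ m"
      by (simp add: xx algebra_simps)
    hence "(of_nat (Suc m) + c - a - 1) * (a * z $ Suc m) =
        (c - a - 1) * (a * y $ Suc m) + (of_nat m + b) * (a * z $ m)"
      by algebra
    hence "of_nat (Suc m) * (c + of_nat m) * y $ Suc m = (of_nat m + b) * (of_nat m + a) * y $ m"
      unfolding z by (simp add: algebra_simps)
    hence "y $ Suc m = y $ m * ((a + of_nat m) * (b + of_nat m) / ((c + of_nat m) * of_nat (Suc m)))"
      using cm by (simp add: nonzero_eq_divide_eq mult_ac add.commute del: of_nat_Suc)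
    thus ?case by (simp add: Suc.IH hypergeo_nth_Suc[OF c])
  qed (simp add: y0)
qed

text \<open>
  The system of \<open>hypergeo_unique\<close> after the substitution \<open>z = w(s)\<close>; since \<open>w'(0) \<noteq> 0\<close>, the
  substitution can be undone.
\<close>
lemma hypergeo_pullback:
  assumes c: "c \<notin> \<int>" and a: "a \<noteq> 0" and Y0: "Y $ 0 = 1"
    and w0: "w $ 0 = 0" and w1: "w $ 1 \<noteq> 0"
    and 1: "w * fps_deriv Y = fps_const a * fps_deriv w * (Z - Y)"
    and 2: "w * (1 - w) * fps_deriv Z = fps_deriv w *
       (fps_const (c - a - 1) * Y - (fps_const (c - a - 1) - fps_const b * w) * Z)"
  shows "hypergeo a b c oo w = Y"
proof -
  define i where "i = fps_inv w"
  have i0: "i $ 0 = 0" by (simp add: i_def fps_inv_def)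
  have wi: "w oo i = fps_X" unfolding i_def by (rule fps_inv_right[OF w0 w1])
  have iw: "i oo w = fps_X" unfolding i_def by (rule fps_inv[OF w0 w1])
  have d: "(fps_deriv w oo i) * fps_deriv i = 1"
    using arg_cong[OF wi, of fps_deriv] by (simp add: fps_compose_deriv[OF i0])
  note dist = fps_compose_mult_distrib[OF i0] fps_compose_sub_distrib fps_compose_add_distrib
  have "Y oo i = hypergeo a b c"
  proof (rule hypergeo_unique[OF c a])
    show "(Y oo i) $ 0 = 1" by (simp add: Y0)
    have "fps_X * (fps_deriv Y oo i) = fps_const a * (fps_deriv w oo i) * ((Z oo i) - (Y oo i))"
      using arg_cong[OF 1, of "\<lambda>f. f oo i"] by (simp add: dist wi)
    hence "fps_X * (fps_deriv Y oo i) * fps_deriv i =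
       fps_const a * ((fps_deriv w oo i) * fps_deriv i) * ((Z oo i) - (Y oo i))"
      by algebra
    thus "fps_X * fps_deriv (Y oo i) = fps_const a * ((Z oo i) - (Y oo i))"
      by (simp add: d fps_compose_deriv[OF i0] mult.assoc)
    have "fps_X * (1 - fps_X) * (fps_deriv Z oo i) = (fps_deriv w oo i) *
       (fps_const (c - a - 1) * (Y oo i) - (fps_const (c - a - 1) - fps_const b * fps_X) * (Z oo i))"
      using arg_cong[OF 2, of "\<lambda>f. f oo i"] by (simp add: dist wi)
    hence "fps_X * (1 - fps_X) * ((fps_deriv Z oo i) * fps_deriv i) = ((fps_deriv w oo i) * fps_deriv i) *
       (fps_const (c - a - 1) * (Y oo i) - (fps_const (c - a - 1) - fps_const b * fps_X) * (Z oo i))"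
      by algebra
    thus "fps_X * (1 - fps_X) * fps_deriv (Z oo i) =
       fps_const (c - a - 1) * (Y oo i) - (fps_const (c - a - 1) - fps_const b * fps_X) * (Z oo i)"
      by (simp add: d fps_compose_deriv[OF i0])
  qed
  hence "hypergeo a b c oo w = Y oo i oo w" by simp
  also have "\<dots> = Y" by (simp add: fps_compose_assoc[OF w0 i0, symmetric] iw)
  finally show ?thesis .
qed

section \<open>The Gegenbauer generating function as a hypergeometric function\<close>

definition gegenbauer_arg :: "complex \<Rightarrow> complex fps" where
  "gegenbauer_arg x = fps_const (x\<^sup>2 - 1) * fps_X\<^sup>2 * inverse ((1 - fps_const x * fps_X)\<^sup>2)"

lemma gegenbauer_arg_nth_0 [simp]: "gegenbauer_arg x $ 0 = 0"
  by (simp add: gegenbauer_arg_def)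

lemma gegenbauer_arg_mult: "(1 - fps_const x * fps_X)\<^sup>2 * gegenbauer_arg x = fps_const (x\<^sup>2 - 1) * fps_X\<^sup>2"
proof -
  have "(1 - fps_const x * fps_X)\<^sup>2 * inverse ((1 - fps_const x * fps_X)\<^sup>2) = 1"
    by (rule inverse_mult_eq_1') simp
  thus ?thesis unfolding gegenbauer_arg_def by algebra
qed

text \<open>
  The point of this expansion is that \<open>\<gamma>\<close> enters only through the factor \<open>pochhammer \<gamma> n\<close>.  The term
  with index \<open>k\<close> contributes \<open>(\<gamma>)_(2 k)\<close>, from the hypergeometric coefficient by the duplication formula,
  and \<open>(\<gamma> + 2 k)_(n - 2 k)\<close>, from the binomial series of exponent \<open>- \<gamma> - 2 k\<close>.
\<close>
lemma gegenbauer_gf_rhs_nth: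
  assumes c: "c \<notin> \<int>"
  shows "(fps_cpow (1 - fps_const x * fps_X) (- \<gamma>) * (hypergeo (\<gamma>/2) (\<gamma>/2 + 1/2) c oo gegenbauer_arg x)) $ n
    = pochhammer \<gamma> n * (\<Sum>k\<le>n. if 2 * k \<le> n then
         (x\<^sup>2 - 1) ^ k * x ^ (n - 2 * k) / (4 ^ k * pochhammer c k * fact k * fact (n - 2 * k)) else 0)"
proof -
  let ?f = "1 - fps_const x * fps_X"
  have f0: "?f $ 0 = 1" by simp
  have *: "fps_cpow ?f (- \<gamma>) * gegenbauer_arg x ^ k =
      fps_const ((x\<^sup>2 - 1) ^ k) * (fps_X ^ (2 * k) * fps_cpow ?f (- (\<gamma> + of_nat (2 * k))))" for k
  proof -
    have "fps_cpow ?f (- (\<gamma> + of_nat (2 * k))) = fps_cpow ?f (- \<gamma> + - of_nat (2 * k))"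
      by simp
    also have "\<dots> = fps_cpow ?f (- \<gamma>) * inverse (?f\<^sup>2) ^ k"
      unfolding fps_cpow_add[OF f0] fps_cpow_minus_of_nat[OF f0]
      by (simp add: fps_inverse_power power_mult[symmetric])
    finally have **: "fps_cpow ?f (- (\<gamma> + of_nat (2 * k))) = fps_cpow ?f (- \<gamma>) * inverse (?f\<^sup>2) ^ k" .
    show ?thesis
      unfolding ** gegenbauer_arg_def power_mult_distrib power_mult[of fps_X 2 k] fps_const_power
      by (simp only: mult_ac)
  qed
  have t: "hypergeo (\<gamma>/2) (\<gamma>/2 + 1/2) c $ k * (fps_cpow ?f (- \<gamma>) * gegenbauer_arg x ^ k) $ n =
     pochhammer \<gamma> n * (if 2 * k \<le> n then
         (x\<^sup>2 - 1) ^ k * x ^ (n - 2 * k) / (4 ^ k * pochhammer c k * fact k * fact (n - 2 * k)) else 0)" for k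
  proof (cases "2 * k \<le> n")
    case True
    have p: "pochhammer \<gamma> n = pochhammer \<gamma> (2 * k) * pochhammer (\<gamma> + of_nat (2 * k)) (n - 2 * k)"
      by (rule pochhammer_product[OF True])
    have d: "pochhammer \<gamma> (2 * k) = 4 ^ k * pochhammer (\<gamma>/2) k * pochhammer (\<gamma>/2 + 1/2) k"
      using pochhammer_double[of "\<gamma>/2" k] by (simp add: power_mult)
    show ?thesis
      unfolding * p d fps_mult_left_const_nth fps_X_power_mult_nth fps_cpow_linear_nth using True
      by (simp add: hypergeo_def mult_ac)
  next
    case False
    thus ?thesis unfolding * by (simp add: fps_X_power_mult_nth)
  qed
  show ?thesis
    by (simp add: fps_mult_compose_nth t sum_distrib_left)
qed

lemma nonint_half: "2 * lam \<notin> \<int> \<Longrightarrow> lam + 1/2 \<notin> (\<int> :: complex set)"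
proof
  assume a: "2 * lam \<notin> \<int>" "lam + 1/2 \<in> \<int>"
  hence "2 * (lam + 1/2) - 1 \<in> \<int>" by (intro Ints_diff Ints_mult) auto
  thus False using a by simp
qed

text \<open>
  For \<open>\<gamma> = 2 \<lambda>\<close> the hypergeometric series degenerates to the binomial series \<open>(1 - \<zeta>)^(-\<lambda>)\<close>, and
  \<open>(1 - x t)\<^sup>2 (1 - \<zeta>) = 1 - 2 x t + t\<^sup>2\<close>.
\<close>
lemma gegenbauer_eq_binomial:
  assumes "2 * lam \<notin> \<int>"
  shows "fps_cpow (1 - fps_const x * fps_X) (- (2 * lam)) *
           (hypergeo (2 * lam / 2) (2 * lam / 2 + 1/2) (lam + 1/2) oo gegenbauer_arg x) =
         fps_cpow (1 - fps_const (2 * x) * fps_X + fps_X\<^sup>2) (- lam)"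
proof -
  let ?f = "1 - fps_const x * fps_X"
  have c: "lam + 1/2 \<notin> \<int>" using assms by (rule nonint_half)
  have "hypergeo lam (lam + 1/2) (lam + 1/2) = fps_cpow (1 - fps_const 1 * fps_X) (- lam)"
    by (rule fps_ext, unfold fps_cpow_linear_nth) (simp add: hypergeo_def nonint_pochhammer[OF c])
  hence "hypergeo (2 * lam / 2) (2 * lam / 2 + 1/2) (lam + 1/2) oo gegenbauer_arg x = fps_cpow (1 - gegenbauer_arg x) (- lam)"
    by (simp add: fps_cpow_compose fps_compose_sub_distrib fps_X_fps_compose_startby0)
  moreover have "fps_cpow ?f (- (2 * lam)) = fps_cpow ?f (- lam) * fps_cpow ?f (- lam)"
    by (subst fps_cpow_add[symmetric]) simp_all
  ultimately have "fps_cpow ?f (- (2 * lam)) * (hypergeo (2 * lam / 2) (2 * lam / 2 + 1/2) (lam + 1/2) oo gegenbauer_arg x)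
     = fps_cpow (?f * ?f * (1 - gegenbauer_arg x)) (- lam)"
    by (simp add: fps_cpow_mult)
  also have "?f * ?f * (1 - gegenbauer_arg x) = ?f\<^sup>2 - ?f\<^sup>2 * gegenbauer_arg x"
    by (simp add: algebra_simps power2_eq_square)
  also have "\<dots> = 1 - fps_const (2 * x) * fps_X + fps_X\<^sup>2"
  proof -
    have "fps_const (x\<^sup>2 - 1) = fps_const x ^ 2 - 1" "fps_const (2 * x) = 2 * fps_const x"
      by (simp_all add: power2_eq_square numeral_fps_const flip: fps_const_sub)
    thus ?thesis unfolding gegenbauer_arg_mult by algebra
  qed
  finally show ?thesis .
qed

text \<open>
  By \<open>gegenbauer_gf_rhs_nth\<close> it is enough to know one value of \<open>\<gamma>\<close>, and \<open>\<gamma> = 2 \<lambda>\<close> is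
  \<open>gegenbauer_eq_binomial\<close>.
\<close>
lemma gegenbauer_gf_eq:
  assumes "2 * lam \<notin> \<int>"
  shows "gegenbauer_gf \<gamma> lam x = fps_cpow (1 - fps_const x * fps_X) (- \<gamma>) *
     (hypergeo (\<gamma>/2) (\<gamma>/2 + 1/2) (lam + 1/2) oo gegenbauer_arg x)"
proof (rule fps_ext)
  fix n
  have c: "lam + 1/2 \<notin> \<int>" using assms by (rule nonint_half)
  define T where "T = (\<Sum>k\<le>n. if 2 * k \<le> n then
         (x\<^sup>2 - 1) ^ k * x ^ (n - 2 * k) / (4 ^ k * pochhammer (lam + 1/2) k * fact k * fact (n - 2 * k)) else 0)"
  have "gegenbauer n lam x = pochhammer (2 * lam) n * T"
    unfolding gegenbauer_def gegenbauer_eq_binomial[OF assms, symmetric] gegenbauer_gf_rhs_nth[OF c] T_def ..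
  thus "gegenbauer_gf \<gamma> lam x $ n = (fps_cpow (1 - fps_const x * fps_X) (- \<gamma>) *
     (hypergeo (\<gamma>/2) (\<gamma>/2 + 1/2) (lam + 1/2) oo gegenbauer_arg x)) $ n"
    unfolding gegenbauer_gf_rhs_nth[OF c] T_def[symmetric]
    using nonint_pochhammer[OF assms, of n] by (simp add: gegenbauer_gf_def)
qed

section \<open>Convergence\<close>

lemma linear_ratio_tendsto_1:
  "(\<lambda>n. (c + of_nat n) / (a + of_nat n)) \<longlonglongrightarrow> (1::complex)" if a: "a \<notin> \<int>"
proof -
  have "filterlim (\<lambda>n. a + of_nat n :: complex) at_infinity sequentially"
    by (rule tendsto_add_filterlim_at_infinity[OF tendsto_const tendsto_of_nat])
  hence "(\<lambda>n. (c - a) / (a + of_nat n)) \<longlonglongrightarrow> 0"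
    by (intro tendsto_divide_0[OF tendsto_const])
  hence "(\<lambda>n. 1 + (c - a) / (a + of_nat n)) \<longlonglongrightarrow> 1 + 0"
    by (intro tendsto_add tendsto_const)
  moreover have "1 + (c - a) / (a + of_nat n) = (c + of_nat n) / (a + of_nat n)" for n
    using nonint_add_nat[OF a, of n] by (simp add: field_simps)
  ultimately show ?thesis by simp
qed

lemma fps_conv_radius_hypergeo:
  assumes a: "a \<notin> \<int>" and b: "b \<notin> \<int>" and c: "c \<notin> \<int>"
  shows "fps_conv_radius (hypergeo a b c) = 1"
  unfolding fps_conv_radius_def
proof (rule conv_radius_ratio_limit_nonzero)
  let ?h = "hypergeo a b c"
  have "(\<lambda>n. norm ((c + of_nat n) / (a + of_nat n) * ((1 + of_nat n) / (b + of_nat n)))) \<longlonglongrightarrow> norm (1 * 1 :: complex)"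
    by (intro tendsto_norm tendsto_mult linear_ratio_tendsto_1 a b)
  moreover have "norm ((c + of_nat n) / (a + of_nat n) * ((1 + of_nat n) / (b + of_nat n))) =
      norm (?h $ n) / norm (?h $ Suc n)" for n
  proof -
    have "?h $ n \<noteq> 0"
      by (simp add: hypergeo_def nonint_pochhammer a b c)
    thus ?thesis unfolding hypergeo_nth_Suc[OF c]
      by (simp add: norm_mult norm_divide)
  qed
  ultimately show "(\<lambda>n. norm (?h $ n) / norm (?h $ Suc n)) \<longlonglongrightarrow> 1" by simp
qed auto

lemma fps_conv_radius_compose_pos:
  fixes f g :: "complex fps"
  assumes "fps_conv_radius f > 0" "fps_conv_radius g > 0" "g $ 0 = 0"
  shows "fps_conv_radius (f oo g) > 0"
  using has_fps_expansion_compose[OF eval_fps_has_fps_expansion eval_fps_has_fps_expansion] assms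
  by (auto simp: has_fps_expansion_def)

lemma fps_conv_radius_mult_pos:
  fixes f g :: "complex fps"
  assumes "fps_conv_radius f > 0" "fps_conv_radius g > 0"
  shows "fps_conv_radius (f * g) > 0"
  using fps_conv_radius_mult[of f g] assms by (meson less_le_trans min_less_iff_conj)

lemma fps_conv_radius_gegenbauer_gf:
  assumes "2 * lam \<notin> \<int>" and g: "\<gamma> \<notin> \<int>"
  shows "fps_conv_radius (gegenbauer_gf \<gamma> lam x) > 0"
proof -
  have lin: "1 - fps_const x * fps_X = fps_of_poly [:1, - x:]"
    by (simp add: fps_of_poly_linear')
  have r: "fps_conv_radius (1 - fps_const x * fps_X) > 0" unfolding lin by simp
  have "1 - fps_const x * fps_X - 1 = fps_of_poly [:0, - x:]"
    by (simp add: fps_of_poly_pCons)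
  hence "fps_conv_radius (1 - fps_const x * fps_X - 1) > 0"
    by (simp only: fps_conv_radius_fps_of_poly) simp
  hence "fps_conv_radius (fps_cpow (1 - fps_const x * fps_X) (- \<gamma>)) > 0"
    unfolding fps_cpow_def
    by (rule fps_conv_radius_compose_pos[rotated]) (simp_all add: fps_conv_radius_binomial)
  moreover have "fps_conv_radius (gegenbauer_arg x) > 0"
  proof -
    have "(1 - fps_const x * fps_X)\<^sup>2 = fps_of_poly ([:1, - x:]\<^sup>2)" "fps_const (x\<^sup>2 - 1) * fps_X\<^sup>2 = fps_of_poly (monom (x\<^sup>2 - 1) 2)"
      by (simp_all add: lin fps_of_poly_power fps_of_poly_monom)
    thus ?thesis unfolding gegenbauer_arg_def
      by (simp only:) (intro fps_conv_radius_mult_pos fps_conv_radius_inverse_pos; simp add: coeff_0_power)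
  qed
  moreover have "\<gamma>/2 \<notin> \<int>" "\<gamma>/2 + 1/2 \<notin> \<int>"
  proof -
    have "2 * (\<gamma>/2) \<notin> \<int>" using g by simp
    from nonint_half[OF this] show "\<gamma>/2 + 1/2 \<notin> \<int>" by simp
    show "\<gamma>/2 \<notin> \<int>" using g Ints_mult[of 2 "\<gamma>/2"] by auto
  qed
  hence "fps_conv_radius (hypergeo (\<gamma>/2) (\<gamma>/2 + 1/2) (lam + 1/2)) > 0"
    by (simp add: fps_conv_radius_hypergeo nonint_half assms)
  ultimately show ?thesis
    unfolding gegenbauer_gf_eq[OF assms(1)]
    by (intro fps_conv_radius_mult_pos fps_conv_radius_compose_pos) auto
qed

section \<open>Elimination over an integral domain\<close>

text \<open>
  Gaussian elimination without division: a pivot \<open>v j n\<close> removes coordinate \<open>n\<close> from the other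
  vectors after they are multiplied by it.
\<close>
lemma homogeneous_system_nontrivial_solution:
  fixes v :: "'k \<Rightarrow> nat \<Rightarrow> 'r::idom"
  assumes "finite K" "n < card K"
  shows "\<exists>r. (\<exists>k\<in>K. r k \<noteq> 0) \<and> (\<forall>i<n. (\<Sum>k\<in>K. r k * v k i) = 0)"
  using assms
proof (induction n arbitrary: K v)
  case 0
  hence "K \<noteq> {}" by auto
  thus ?case by (intro exI[of _ "\<lambda>_. 1"]) auto
next
  case (Suc n)
  show ?case
  proof (cases "\<forall>k\<in>K. v k n = 0")
    case True
    obtain r where r: "\<exists>k\<in>K. r k \<noteq> 0" "\<forall>i<n. (\<Sum>k\<in>K. r k * v k i) = 0"
      using Suc.IH[of K v] Suc.prems by auto
    have "(\<Sum>k\<in>K. r k * v k i) = 0" if "i < Suc n" for i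
      using that r(2) True by (cases "i = n") auto
    thus ?thesis using r(1) by blast
  next
    case False
    then obtain j where j: "j \<in> K" "v j n \<noteq> 0" by blast
    define K' where "K' = K - {j}"
    define v' where "v' = (\<lambda>k i. v j n * v k i - v k n * v j i)"
    have K': "finite K'" "n < card K'" "j \<notin> K'" "K = insert j K'"
      using Suc.prems j by (auto simp: K'_def)
    obtain r where r: "\<exists>k\<in>K'. r k \<noteq> 0" "\<forall>i<n. (\<Sum>k\<in>K'. r k * v' k i) = 0"
      using Suc.IH[OF K'(1,2), of v'] by auto
    define r' where "r' = (\<lambda>k. if k = j then - (\<Sum>k\<in>K'. r k * v k n) else v j n * r k)"
    have s: "(\<Sum>k\<in>K. r' k * v k i) = (\<Sum>k\<in>K'. r k * v' k i)" for i
    proof -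
      have "(\<Sum>k\<in>K. r' k * v k i) = r' j * v j i + (\<Sum>k\<in>K'. r' k * v k i)"
        using K' by simp
      also have "(\<Sum>k\<in>K'. r' k * v k i) = (\<Sum>k\<in>K'. v j n * r k * v k i)"
        using K'(3) by (intro sum.cong) (auto simp: r'_def)
      also have "r' j * v j i + \<dots> = (\<Sum>k\<in>K'. r k * v' k i)"
        by (simp add: r'_def v'_def sum_distrib_left sum_distrib_right sum_subtractf right_diff_distrib mult_ac)
      finally show ?thesis .
    qed
    have "(\<Sum>k\<in>K. r' k * v k i) = 0" if "i < Suc n" for i
      unfolding s using that r(2) by (cases "i = n") (auto simp: v'_def)
    moreover have "\<exists>k\<in>K. r' k \<noteq> 0"
      using r(1) K' j by (auto simp: r'_def)
    ultimately show ?thesis by blast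
  qed
qed

text \<open>
  Evaluations at different \<open>x\<close> are different morphisms from \<open>\<complex>[x][t]\<close> to the power series in \<open>t\<close>.
  The elimination below has to produce one polynomial for all of them, so it quantifies over morphisms.
\<close>
definition ring_morphism :: "('r::comm_ring_1 \<Rightarrow> 's::comm_ring_1) \<Rightarrow> bool" where
  "ring_morphism \<phi> \<longleftrightarrow> \<phi> 0 = 0 \<and> \<phi> 1 = 1 \<and> (\<forall>a b. \<phi> (a + b) = \<phi> a + \<phi> b) \<and> (\<forall>a b. \<phi> (a * b) = \<phi> a * \<phi> b)"

lemma ring_morphism_simps:
  assumes "ring_morphism \<phi>"
  shows "\<phi> 0 = 0" "\<phi> 1 = 1" "\<phi> (a + b) = \<phi> a + \<phi> b" "\<phi> (a * b) = \<phi> a * \<phi> b"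
    "\<phi> (a ^ n) = \<phi> a ^ n" "\<phi> (\<Sum>k\<in>K. f k) = (\<Sum>k\<in>K. \<phi> (f k))" "\<phi> (- a) = - \<phi> a" "\<phi> (a - b) = \<phi> a - \<phi> b"
proof -
  show *: "\<phi> 0 = 0" "\<phi> 1 = 1" "\<phi> (a + b) = \<phi> a + \<phi> b" "\<phi> (a * b) = \<phi> a * \<phi> b" for a b
    using assms by (auto simp: ring_morphism_def)
  show "\<phi> (a ^ n) = \<phi> a ^ n" by (induction n) (auto simp: *)
  show "\<phi> (\<Sum>k\<in>K. f k) = (\<Sum>k\<in>K. \<phi> (f k))" by (induction K rule: infinite_finite_induct) (auto simp: *)
  show m: "\<phi> (- a) = - \<phi> a" for a
    using *(3)[of a "- a"] by (simp add: * eq_neg_iff_add_eq_0 add.commute)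
  show "\<phi> (a - b) = \<phi> a - \<phi> b"
    using *(3)[of a "- b"] by (simp add: m)
qed

lemma poly_map_poly_pCons:
  "\<phi> 0 = 0 \<Longrightarrow> poly (map_poly \<phi> (pCons a p)) s = \<phi> a + s * poly (map_poly \<phi> p) (s :: 's::comm_ring_1)"
  by (simp add: map_poly_pCons)

lemma ring_morphism_poly:
  fixes \<phi> :: "'r::comm_ring_1 \<Rightarrow> 's::comm_ring_1"
  assumes \<phi>: "ring_morphism \<phi>"
  shows "ring_morphism (\<lambda>p. poly (map_poly \<phi> p) s)"
proof -
  note [simp] = ring_morphism_simps(1-4)[OF \<phi>]
  define E where "E = (\<lambda>p. poly (map_poly \<phi> p) s)"
  have pC: "E (pCons a p) = \<phi> a + s * E p" for a p
    by (simp add: E_def poly_map_poly_pCons)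
  have 0: "E 0 = 0" by (simp add: E_def)
  have 1: "E 1 = 1" by (simp add: E_def)
  have add: "E (p + q) = E p + E q" for p q
    by (induction p q rule: poly_induct2) (simp_all add: pC 0 algebra_simps)
  have sm: "E (smult c p) = \<phi> c * E p" for c p
    by (induction p) (simp_all add: pC 0 algebra_simps)
  have "E (p * q) = E p * E q" for p q
    by (induction p) (simp_all add: pC 0 add sm algebra_simps)
  thus ?thesis using 0 1 add unfolding ring_morphism_def E_def by blast
qed

lemma poly_map_poly_const:
  "ring_morphism \<phi> \<Longrightarrow> poly (map_poly \<phi> [:c:]) s = \<phi> c"
  by (simp add: ring_morphism_simps map_poly_pCons)

lemma poly_map_poly_smult:
  assumes "ring_morphism \<phi>"
  shows "poly (map_poly \<phi> (smult c p)) s = \<phi> c * poly (map_poly \<phi> p) s"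
  using ring_morphism_simps(4)[OF ring_morphism_poly[OF assms], of "[:c:]" p s]
  by (simp add: poly_map_poly_const[OF assms])

text \<open>
  Let \<open>s\<close> be a root of \<open>B\<close> and \<open>y^N = C(s) / A(s)\<close>.  With \<open>n = degree B\<close>, the elements
  \<open>A^n y^(N k) = A^(n - k) C^k\<close>, for \<open>k = 0, \<dots>, n\<close>, are polynomials in \<open>s\<close>.  Modulo \<open>B\<close> each of
  them has, up to a nonzero factor, a representative of degree less than \<open>n\<close>.  These are \<open>n + 1\<close>
  vectors with \<open>n\<close> coordinates, hence linearly dependent, and the dependence is a polynomial relation
  for \<open>y\<close>.  Leading coefficients are never inverted, so the relation survives every morphism under
  which \<open>A(s)\<close> stays nonzero.
\<close>
lemma elimination:
  fixes A B C :: "'r::idom poly"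
  assumes B: "B \<noteq> 0" and N: "N > 0"
  obtains P :: "'r poly" where "P \<noteq> 0"
    "\<And>(\<phi> :: 'r \<Rightarrow> 's::idom) s y. ring_morphism \<phi> \<Longrightarrow> poly (map_poly \<phi> B) s = 0 \<Longrightarrow>
       poly (map_poly \<phi> A) s * y ^ N = poly (map_poly \<phi> C) s \<Longrightarrow> poly (map_poly \<phi> A) s \<noteq> 0 \<Longrightarrow>
       poly (map_poly \<phi> P) y = 0"
proof -
  define n where "n = degree B"
  define f where "f k = A ^ (n - k) * C ^ k" for k
  define R where "R k = pseudo_mod (f k) B" for k
  have "\<forall>k. \<exists>a q. a \<noteq> 0 \<and> smult a (f k) = B * q + R k"
    unfolding R_def using pseudo_mod(1)[OF B] by blast
  then obtain a q where a: "\<And>k. a k \<noteq> 0" and q: "\<And>k. smult (a k) (f k) = B * q k + R k"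
    by metis
  have R: "coeff (R k) i = 0" if "i \<ge> n" for k i
    using pseudo_mod(2)[OF B, of "f k"] that
    by (auto simp: R_def n_def intro: coeff_eq_0)
  obtain r where r: "\<exists>k\<in>{..n}. r k \<noteq> 0" "\<forall>i<n. (\<Sum>k\<in>{..n}. r k * coeff (R k) i) = 0"
    using homogeneous_system_nontrivial_solution[of "{..n}" n "\<lambda>k. coeff (R k)"] by auto
  have "(\<Sum>k\<le>n. smult (r k) (R k)) = 0"
  proof (rule poly_eqI)
    fix i show "coeff (\<Sum>k\<le>n. smult (r k) (R k)) i = coeff 0 i"
      using r(2) R by (cases "i < n") (simp_all add: coeff_sum)
  qed
  hence rel: "(\<Sum>k\<le>n. smult (r k * a k) (f k)) = B * (\<Sum>k\<le>n. smult (r k) (q k))"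
    by (simp add: smult_smult[symmetric] q smult_add_right sum.distrib sum_distrib_left del: smult_smult)
  define P where "P = (\<Sum>k\<le>n. monom (r k * a k) (N * k))"
  have "P \<noteq> 0"
  proof -
    obtain k where k: "k \<le> n" "r k \<noteq> 0" using r(1) by auto
    have "coeff P (N * k) = (\<Sum>j\<le>n. if j = k then r j * a j else 0)"
      unfolding P_def coeff_sum using N by (intro sum.cong) auto
    also have "\<dots> = r k * a k" using k by simp
    finally show ?thesis using k a by auto
  qed
  moreover have "poly (map_poly \<phi> P) y = 0"
    if \<phi>: "ring_morphism \<phi>" and B0: "poly (map_poly \<phi> B) s = 0"
      and AC: "poly (map_poly \<phi> A) s * y ^ N = poly (map_poly \<phi> C) s" and A0: "poly (map_poly \<phi> A) s \<noteq> 0"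
    for \<phi> :: "'r \<Rightarrow> 's" and s y
  proof -
    note E = ring_morphism_simps[OF ring_morphism_poly[OF \<phi>]]
    note sm = poly_map_poly_smult[OF \<phi>]
    have mon: "poly (map_poly \<phi> (monom c k)) z = \<phi> c * z ^ k" for c k z
      by (simp add: map_poly_monom ring_morphism_simps[OF \<phi>] poly_monom)
    have f: "poly (map_poly \<phi> (f k)) s = poly (map_poly \<phi> A) s ^ n * y ^ (N * k)" if "k \<le> n" for k
    proof -
      have "poly (map_poly \<phi> (f k)) s = poly (map_poly \<phi> A) s ^ (n - k) * (poly (map_poly \<phi> A) s * y ^ N) ^ k"
        by (simp add: f_def E AC)
      also have "\<dots> = (poly (map_poly \<phi> A) s ^ (n - k) * poly (map_poly \<phi> A) s ^ k) * y ^ (N * k)"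
        by (simp add: power_mult_distrib power_mult)
      also have "poly (map_poly \<phi> A) s ^ (n - k) * poly (map_poly \<phi> A) s ^ k = poly (map_poly \<phi> A) s ^ n"
        using that by (simp add: power_add[symmetric])
      finally show ?thesis .
    qed
    have "poly (map_poly \<phi> A) s ^ n * poly (map_poly \<phi> P) y
        = (\<Sum>k\<le>n. \<phi> (r k * a k) * (poly (map_poly \<phi> A) s ^ n * y ^ (N * k)))"
      by (simp add: P_def E mon sum_distrib_left mult_ac)
    also have "\<dots> = poly (map_poly \<phi> (\<Sum>k\<le>n. smult (r k * a k) (f k))) s"
      by (simp add: E sm f)
    also have "\<dots> = 0" unfolding rel by (simp add: E B0)
    finally show ?thesis using A0 by simp
  qed
  ultimately show ?thesis using that by blast
qed

section \<open>Families of power series that are algebraic over polynomials in two variables\<close>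

definition specialize :: "complex \<Rightarrow> complex poly poly \<Rightarrow> complex fps" where
  "specialize x p = poly (map_poly (\<lambda>q. fps_const (poly q x)) p) fps_X"

lemma ring_morphism_specialize: "ring_morphism (specialize x)"
  unfolding specialize_def
  by (rule ring_morphism_poly) (auto simp: ring_morphism_def)

lemma specialize_pCons: "specialize x (pCons q p) = fps_const (poly q x) + fps_X * specialize x p"
  unfolding specialize_def by (rule poly_map_poly_pCons) simp

lemma eval_fps_specialize:
  "fps_conv_radius (specialize x p) = \<infinity> \<and> eval_fps (specialize x p) t = poly (poly p [:t:]) x"
proof (induction p)
  case 0
  thus ?case by (simp add: specialize_def)
next
  case (pCons q p)
  have r: "fps_conv_radius (fps_X * specialize x p) = \<infinity>"
    using fps_conv_radius_mult[of fps_X "specialize x p"] pCons.IH by simp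
  hence "fps_conv_radius (specialize x (pCons q p)) = \<infinity>"
    using fps_conv_radius_add[of "fps_const (poly q x)" "fps_X * specialize x p"]
    by (simp add: specialize_pCons)
  moreover have "eval_fps (specialize x (pCons q p)) t = poly (poly (pCons q p) [:t:]) x"
    using pCons.IH r by (simp add: specialize_pCons eval_fps_add eval_fps_mult)
  ultimately show ?case by blast
qed

text \<open>
  A relation between power series in \<open>t\<close> may be evaluated wherever \<open>F x\<close> converges, because its
  coefficients are polynomials in \<open>t\<close>.
\<close>
lemma defines_algebraic_functionI:
  assumes rad: "\<And>x. fps_conv_radius (F x) > 0" and "P \<noteq> 0"
    and P: "\<And>x. poly (map_poly (specialize x) P) (F x) = 0"
  shows "defines_algebraic_function F"
  unfolding defines_algebraic_function_def
proof (intro conjI allI exI[of _ P] impI)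
  fix x t :: complex assume t: "ereal (norm t) < fps_conv_radius (F x)"
  note M = ring_morphism_simps[OF ring_morphism_specialize]
  have "fps_conv_radius (poly (map_poly (specialize x) Q) (F x)) \<ge> fps_conv_radius (F x) \<and>
    eval_fps (poly (map_poly (specialize x) Q) (F x)) t = poly3 Q x t (eval_fps (F x) t)" for Q
  proof (induction Q)
    case 0
    thus ?case by (simp add: poly3_def)
  next
    case (pCons p Q)
    let ?E = "poly (map_poly (specialize x) Q) (F x)"
    have r: "fps_conv_radius (F x * ?E) \<ge> fps_conv_radius (F x)"
      using fps_conv_radius_mult[of "F x" ?E] pCons.IH by (metis min.absorb1)
    have "fps_conv_radius (specialize x p + F x * ?E) \<ge> fps_conv_radius (F x)"
      using fps_conv_radius_add[of "specialize x p" "F x * ?E"] r eval_fps_specialize[of x p t] by simp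
    moreover have "eval_fps (specialize x p + F x * ?E) t = poly3 (pCons p Q) x t (eval_fps (F x) t)"
    proof -
      have "ereal (norm t) < fps_conv_radius (F x * ?E)" "ereal (norm t) < fps_conv_radius ?E"
        using t r pCons.IH by (blast intro: less_le_trans)+
      thus ?thesis using pCons.IH t eval_fps_specialize[of x p t]
        by (simp add: eval_fps_add eval_fps_mult poly3_def)
    qed
    ultimately show ?case by (simp add: poly_map_poly_pCons M)
  qed
  from this[of P] show "poly3 P x t (eval_fps (F x) t) = 0"
    using P[of x] by simp
qed (use assms in auto)

lemma poly_map_poly_lift:
  assumes "s $ 0 = 0"
  shows "poly (map_poly (specialize x) (map_poly (\<lambda>c. [:[:c:]:]) p)) s = fps_of_poly p oo s"
proof (induction p)
  case (pCons c p)
  have "specialize x [:[:c:]:] = fps_const c"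
    by (simp add: specialize_pCons ring_morphism_simps[OF ring_morphism_specialize])
  thus ?case using pCons.IH
    by (simp add: map_poly_pCons poly_map_poly_pCons ring_morphism_simps[OF ring_morphism_specialize]
       fps_of_poly_pCons fps_compose_add_distrib fps_compose_mult_distrib[OF assms]
       fps_X_fps_compose_startby0[OF assms] mult.commute)
qed simp

section \<open>Schwarz maps and closed forms along them\<close>

lemma log_deriv_mult:
  fixes f g :: "complex fps"
  assumes "q * fps_deriv f = p * f" "q * fps_deriv g = p' * g"
  shows "q * fps_deriv (f * g) = (p + p') * (f * g)"
  using assms by simp algebra

lemma log_deriv_power:
  fixes f :: "complex fps"
  assumes "q * fps_deriv f = p * f"
  shows "q * fps_deriv (f ^ n) = of_nat n * p * f ^ n"
proof (induction n)
  case (Suc n)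
  from log_deriv_mult[OF assms this] show ?case by (simp add: algebra_simps)
qed simp

lemma log_deriv_inverse:
  fixes f :: "complex fps"
  assumes "f $ 0 \<noteq> 0"
  shows "f * fps_deriv (inverse f) = - fps_deriv f * inverse f"
proof -
  have 1: "f * inverse f = 1" using assms by (rule inverse_mult_eq_1')
  hence "fps_deriv (f * inverse f) = 0" by simp
  hence "f * (f * fps_deriv (inverse f)) = f * (- fps_deriv f * inverse f)"
    by simp algebra
  moreover have "f \<noteq> 0" using assms by auto
  ultimately show ?thesis by (metis mult_cancel_left)
qed

text \<open>
  The closed form to be established is \<open>Y = E^\<gamma> A^-\<alpha> B^-\<beta>\<close>.  Its logarithmic
  derivative is \<open>- (\<gamma>/2) S / (A B E)\<close>, where \<open>S\<close> is \<open>log_deriv_numerator\<close>.  The contiguous series with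
  \<open>\<gamma>/2\<close> raised by 1 has to be, along a Schwarz map and with \<open>R\<close> for \<open>raised_numerator\<close>,
  \<open>E^(\<gamma>+1) R A^-\<alpha> B^-(\<beta>+n+1)\<close>.
\<close>
definition raised_numerator :: "nat \<Rightarrow> complex poly \<Rightarrow> complex poly \<Rightarrow> complex \<Rightarrow> nat \<Rightarrow> nat \<Rightarrow> complex poly" where
  "raised_numerator m A B \<gamma> \<alpha> \<beta> = (A + smult (of_nat (Suc m)) ([:0, 1:] * pderiv A)) * B
     - smult (2 / \<gamma>) ([:0, 1:] * (smult (of_nat \<alpha>) (pderiv A * B) + smult (of_nat \<beta>) (A * pderiv B)))"

definition log_deriv_numerator :: "complex poly \<Rightarrow> complex poly \<Rightarrow> complex poly \<Rightarrow> complex \<Rightarrow> nat \<Rightarrow> nat \<Rightarrow> complex poly" where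
  "log_deriv_numerator A B E \<gamma> \<alpha> \<beta> =
     smult (2 / \<gamma>) (E * (smult (of_nat \<alpha>) (pderiv A * B) + smult (of_nat \<beta>) (A * pderiv B)))
     - smult 2 (A * B * pderiv E)"

text \<open>
  What is left of the second equation of the pulled-back system (see \<open>hypergeo_pullback\<close>) when all
  common factors are cancelled.  The first equation holds by the choice of \<open>R\<close>.
\<close>
definition certificate ::
  "nat \<Rightarrow> nat \<Rightarrow> complex poly \<Rightarrow> complex poly \<Rightarrow> complex poly \<Rightarrow> complex \<Rightarrow> complex \<Rightarrow> nat \<Rightarrow> nat \<Rightarrow> bool" where
  "certificate m n A B E \<gamma> lam \<alpha> \<beta> \<longleftrightarrow>
     A * B * pderiv (raised_numerator m A B \<gamma> \<alpha> \<beta>)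
     - smult (of_nat \<alpha>) (B * raised_numerator m A B \<gamma> \<alpha> \<beta> * pderiv A)
     - smult (of_nat (\<beta> + Suc n) - (\<gamma> / 2 + 1/2) * of_nat (Suc n)) (A * raised_numerator m A B \<gamma> \<alpha> \<beta> * pderiv B)
     = smult (lam - \<gamma> / 2 - 1 / 2) (log_deriv_numerator A B E \<gamma> \<alpha> \<beta>)"

text \<open>
  The map \<open>s \<mapsto> k s A^(m+1) / E\<^sup>2\<close> from the Riemann sphere to itself, ramified over \<open>0\<close>, \<open>1\<close>, \<open>\<infinity>\<close>
  only.  In the three cases below it is the quotient of the sphere by a finite rotation group that
  contains rotations of order \<open>m + 1\<close> about the origin; \<open>s\<close> is proportional to the \<open>(m + 1)\<close>st power
  of the coordinate on that sphere.  The roots of \<open>A\<close>, \<open>B\<close>, \<open>E\<close> are the finite nonzero points with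
  stabilizers of orders \<open>m + 1\<close>, \<open>n + 1\<close>, \<open>2\<close> over \<open>0\<close>, \<open>1\<close>, \<open>\<infinity>\<close>.  The first equation says that
  \<open>1 - k s A^(m+1) / E\<^sup>2 = B^(n+1) / E\<^sup>2\<close>.  The other two express that there is no further ramification:
  each of them amounts to the formula \<open>cover_deriv_E\<close> for the derivative.
\<close>
locale schwarz_map =
  fixes k :: complex and m n :: nat and A B E :: "complex poly"
  assumes k: "k \<noteq> 0" and A0: "coeff A 0 = 1" and B0: "coeff B 0 = 1" and E0: "coeff E 0 = 1"
    and I1: "smult k ([:0, 1:] * A ^ Suc m) + B ^ Suc n = E\<^sup>2"
    and I2: "(A + smult (of_nat (Suc m)) ([:0, 1:] * pderiv A)) * E - smult 2 ([:0, 1:] * A * pderiv E) = B ^ n"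
    and I3: "smult (of_nat (Suc n)) (pderiv B * E) - smult 2 (B * pderiv E) = - smult k (A ^ m)"
begin

definition cover :: "complex fps" where
  "cover = fps_const k * fps_X * fps_of_poly A ^ Suc m * inverse (fps_of_poly E ^ 2)"

lemma cover_E: "cover * fps_of_poly E ^ 2 = fps_const k * fps_X * fps_of_poly A ^ Suc m"
proof -
  have "fps_of_poly E ^ 2 * inverse (fps_of_poly E ^ 2) = 1"
    by (rule inverse_mult_eq_1') (simp add: E0)
  thus ?thesis unfolding cover_def by (simp only: mult.assoc mult.commute[of "inverse _"] mult.right_neutral)
qed

lemma cover_nth_0: "cover $ 0 = 0" by (simp add: cover_def)

lemmas fps_of_poly_hom = fps_of_poly_add fps_of_poly_diff fps_of_poly_mult fps_of_poly_power
  fps_of_poly_smult fps_of_poly_pderiv fps_of_poly_fps_X fps_of_poly_uminus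

lemma one_minus_cover_E: "(1 - cover) * fps_of_poly E ^ 2 = fps_of_poly B ^ Suc n"
  using arg_cong[OF I1, of fps_of_poly] cover_E
  by (simp add: fps_of_poly_hom algebra_simps)

lemma cover_deriv_E: "fps_deriv cover * fps_of_poly E ^ 3 = fps_const k * fps_of_poly A ^ m * fps_of_poly B ^ n"
proof -
  define P N where "P = fps_of_poly A ^ m" and "N = (of_nat (Suc m) :: complex fps)"
  let ?A = "fps_of_poly A" and ?E = "fps_of_poly E"
  have I2': "(?A + N * fps_X * fps_deriv ?A) * ?E - 2 * (fps_X * ?A * fps_deriv ?E) = fps_of_poly B ^ n"
    using arg_cong[OF I2, of fps_of_poly]
    by (simp only: fps_of_poly_hom fps_of_nat numeral_fps_const[symmetric] mult.assoc N_def)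
  have A': "fps_deriv (?A ^ Suc m) = N * P * fps_deriv ?A"
    unfolding N_def P_def by (simp only: fps_deriv_power fps_of_nat diff_Suc_1 mult_ac)
  have "fps_deriv (cover * ?E ^ 2) = fps_deriv (fps_const k * fps_X * ?A ^ Suc m)"
    unfolding cover_E ..
  hence "fps_deriv cover * ?E ^ 2 + 2 * cover * ?E * fps_deriv ?E =
      fps_const k * (P * ?A + fps_X * (N * P * fps_deriv ?A))"
    unfolding A'[symmetric] by (simp add: power2_eq_square algebra_simps P_def del: fps_deriv_power)
  moreover have "cover * ?E ^ 2 = fps_const k * fps_X * P * ?A"
    using cover_E by (simp add: P_def mult_ac)
  ultimately show ?thesis unfolding I2'[symmetric] P_def[symmetric] by algebra
qed

lemma cover_nth_1: "cover $ 1 \<noteq> 0"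
  using arg_cong[OF cover_deriv_E, of "\<lambda>f. f $ 0"] k by (auto simp: A0 B0 E0 fps_power_zeroth)

text \<open>
  With \<open>Z\<close> the closed form of the contiguous series, both equations of the pulled-back system are
  identities between multiples of \<open>U = E^\<gamma> A^-\<alpha> B^-(\<beta>+n+1)\<close>, so they reduce to polynomial
  identities in \<open>A\<close>, \<open>B\<close>, \<open>E\<close> and their derivatives.
\<close>
lemma hypergeo_along_cover:
  fixes \<gamma> lam :: complex and \<alpha> \<beta> :: nat
  assumes cert: "certificate m n A B E \<gamma> lam \<alpha> \<beta>"
    and c: "lam + 1/2 \<notin> \<int>" and \<gamma>: "\<gamma> \<noteq> 0"
  shows "hypergeo (\<gamma>/2) (\<gamma>/2 + 1/2) (lam + 1/2) oo cover
    = fps_cpow (fps_of_poly E) \<gamma> * inverse (fps_of_poly A) ^ \<alpha> * inverse (fps_of_poly B) ^ \<beta>"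
proof -
  define R S where "R = raised_numerator m A B \<gamma> \<alpha> \<beta>" and "S = log_deriv_numerator A B E \<gamma> \<alpha> \<beta>"
  note R_def = R_def[unfolded raised_numerator_def] and S_def = S_def[unfolded log_deriv_numerator_def]
  have ID: "A * B * pderiv R - smult (of_nat \<alpha>) (B * R * pderiv A)
     - smult (of_nat (\<beta> + Suc n) - (\<gamma> / 2 + 1/2) * of_nat (Suc n)) (A * R * pderiv B)
     = smult (lam - \<gamma> / 2 - 1 / 2) S"
    using cert by (simp only: certificate_def Let_def raised_numerator_def log_deriv_numerator_def R_def S_def)
  define a b e r s where "a = fps_of_poly A" and "b = fps_of_poly B" and "e = fps_of_poly E"
    and "r = fps_of_poly R" and "s = fps_of_poly S"
  note abe = a_def[symmetric] b_def[symmetric] e_def[symmetric] r_def[symmetric] s_def[symmetric]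
  define a' b' e' r' where "a' = fps_deriv a" and "b' = fps_deriv b" and "e' = fps_deriv e" and "r' = fps_deriv r"
  note abe' = a'_def[symmetric] b'_def[symmetric] e'_def[symmetric] r'_def[symmetric]
  define ap bn where "ap = a ^ m" and "bn = b ^ n"
  define ca cb cn where "ca = (of_nat \<alpha> :: complex fps)" and "cb = (of_nat \<beta> :: complex fps)"
     and "cn = (of_nat (Suc n) :: complex fps)"
  define g h \<mu> where "g = fps_const \<gamma>" and "h = fps_const (\<gamma>/2 + 1/2)" and "\<mu> = fps_const (lam - \<gamma>/2 - 1/2)"
  have nz: "a \<noteq> 0" "b \<noteq> 0" "e \<noteq> 0" "a $ 0 = 1" "b $ 0 = 1" "e $ 0 = 1"
    using A0 B0 E0 by (auto simp: a_def b_def e_def)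
  have h: "2 * h = g + 1"
    by (simp add: h_def g_def numeral_fps_const distrib_left flip: fps_const_1_eq_1)
  note hom = fps_of_poly_hom abe abe' fps_of_nat numeral_fps_const[symmetric]
  have I2: "(a + of_nat (Suc m) * fps_X * a') * e - 2 * (fps_X * a * e') = bn"
    using arg_cong[OF I2, of fps_of_poly] by (simp only: hom mult.assoc bn_def)
  have I3: "cn * (b' * e) - 2 * (b * e') = - (fps_const k * ap)"
    using arg_cong[OF I3, of fps_of_poly] by (simp only: hom cn_def ap_def)
  have g2: "g * fps_const (2 / \<gamma>) = 2"
    using \<gamma> by (simp add: g_def numeral_fps_const)
  have r: "r = (a + of_nat (Suc m) * fps_X * a') * b - fps_const (2/\<gamma>) * (fps_X * (ca * a' * b + cb * a * b'))"
    unfolding r_def R_def by (simp only: hom ca_def cb_def mult.assoc)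
  have s: "s = fps_const (2/\<gamma>) * (e * (ca * a' * b + cb * a * b')) - 2 * (a * b * e')"
    unfolding s_def S_def by (simp only: hom ca_def cb_def mult.assoc)
  have ID': "a * b * r' - ca * b * r * a' - (cb + cn - h * cn) * a * r * b' = \<mu> * s"
  proof -
    have *: "fps_const (of_nat (\<beta> + Suc n) - (\<gamma> / 2 + 1/2) * of_nat (Suc n)) = cb + cn - h * cn"
      unfolding cb_def cn_def h_def fps_of_nat[symmetric] by simp
    show ?thesis
      using arg_cong[OF ID, of fps_of_poly] by (simp only: hom * ca_def \<mu>_def mult.assoc)
  qed
  \<comment> \<open>This identity makes the first equation hold: it says that \<open>Z - Y = - s S U\<close>.\<close>
  have F1: "fps_X * s = (b * bn) - e * r"
    unfolding s r I2[symmetric] by algebra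
  have F2: "2 * (g * e' * a * b - ca * a' * b * e - cb * a * b' * e) = - g * s"
  proof -
    have "- g * s = - (g * fps_const (2 / \<gamma>)) * (e * (ca * a' * b + cb * a * b')) + g * (2 * (a * b * e'))"
      unfolding s by (simp only: right_diff_distrib mult.assoc minus_mult_left[symmetric]) simp
    thus ?thesis unfolding g2 by (simp add: algebra_simps)
  qed
  define U Y Z where "U = fps_cpow e \<gamma> * inverse a ^ \<alpha> * inverse b ^ (\<beta> + Suc n)"
    and "Y = fps_cpow e \<gamma> * inverse a ^ \<alpha> * inverse b ^ \<beta>" and "Z = U * (e * r)"
  have ld: "a * b * e * fps_deriv (fps_cpow e \<gamma> * inverse a ^ \<alpha> * inverse b ^ j) =
       (g * e' * a * b - ca * a' * b * e - of_nat j * a * b' * e) * (fps_cpow e \<gamma> * inverse a ^ \<alpha> * inverse b ^ j)" for j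
  proof -
    have 1: "a * b * e * fps_deriv (fps_cpow e \<gamma>) = (g * e' * a * b) * fps_cpow e \<gamma>"
      using fps_cpow_deriv[OF nz(6), of \<gamma>] unfolding g_def e'_def by algebra
    have 2: "a * b * e * fps_deriv (inverse a) = (- a' * b * e) * inverse a"
      using log_deriv_inverse[of a, unfolded nz, OF one_neq_zero] unfolding a'_def by algebra
    have 3: "a * b * e * fps_deriv (inverse b) = (- a * b' * e) * inverse b"
      using log_deriv_inverse[of b, unfolded nz, OF one_neq_zero] unfolding b'_def by algebra
    show ?thesis
      using log_deriv_mult[OF log_deriv_mult[OF 1 log_deriv_power[OF 2, of \<alpha>]] log_deriv_power[OF 3, of j]]
      by (simp add: ca_def algebra_simps)
  qed
  have dY: "2 * (a * b * e * fps_deriv Y) = - g * s * Y"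
    using ld[of \<beta>] F2 unfolding Y_def[symmetric] cb_def by algebra
  have dU: "a * b * e * fps_deriv U = (g * e' * a * b - ca * a' * b * e - (cb + cn) * a * b' * e) * U"
    using ld[of "\<beta> + Suc n"] unfolding U_def[symmetric] cb_def cn_def of_nat_add .
  have YU: "Y = U * (b * bn)"
  proof -
    have "b * inverse b = 1" using nz by (intro inverse_mult_eq_1') auto
    hence "inverse b ^ Suc n * (b * bn) = 1"
      unfolding bn_def power_Suc[symmetric] by (metis power_mult_distrib power_one mult.commute)
    thus ?thesis unfolding U_def Y_def power_add by (simp only: mult.assoc mult_1_right)
  qed
  have W: "cover * e ^ 2 = fps_const k * fps_X * ap * a" "(1 - cover) * e ^ 2 = bn * b"
    "fps_deriv cover * e ^ 3 = fps_const k * ap * bn"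
    using cover_E one_minus_cover_E cover_deriv_E by (simp_all add: a_def b_def e_def ap_def bn_def mult_ac)
  have "hypergeo (\<gamma>/2) (\<gamma>/2 + 1/2) (lam + 1/2) oo cover = Y"
  proof (rule hypergeo_pullback[OF c _ _ cover_nth_0 cover_nth_1])
    show "\<gamma> / 2 \<noteq> 0" using \<gamma> by simp
    show "Y $ 0 = 1" by (simp add: Y_def nz fps_power_zeroth)
    have g': "2 * fps_const (\<gamma> / 2) = g" by (simp add: g_def numeral_fps_const)
    have ZY: "Z - Y = - (fps_X * s * U)"
      unfolding F1 YU Z_def by algebra
    \<comment> \<open>Denominators: the factor \<open>e ^ 3\<close> clears those of the map and of its derivative, \<open>b\<close> that of the logarithmic derivative.\<close>
    have "2 * e ^ 3 * b * (cover * fps_deriv Y) = (fps_const k * fps_X * ap) * (2 * (a * b * e * fps_deriv Y))"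
      using W(1) by algebra
    also have "\<dots> = (fps_const k * fps_X * ap) * (- g * s * (U * (b * bn)))"
      by (simp only: dY) (simp only: YU)
    also have "\<dots> = g * b * (fps_const k * ap * bn) * (Z - Y)"
      unfolding ZY by algebra
    also have "\<dots> = 2 * e ^ 3 * b * (fps_const (\<gamma>/2) * fps_deriv cover * (Z - Y))"
      unfolding W(3)[symmetric] g'[symmetric] by algebra
    finally show "cover * fps_deriv Y = fps_const (\<gamma> / 2) * fps_deriv cover * (Z - Y)"
      using nz by simp
    have dZ: "a * b * fps_deriv Z = U * (r * (g * e' * a * b - ca * a' * b * e - (cb + cn) * a * b' * e)
        + a * b * (e' * r + e * r'))"
      using dU unfolding Z_def e'_def r'_def by simp algebra
    have "r * (g * e' * a * b - ca * a' * b * e - (cb + cn) * a * b' * e) + a * b * (e' * r + e * r')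
       = e * \<mu> * s + h * (fps_const k * ap * a) * r"
      using ID' I3 h by algebra
    hence dZ': "a * b * fps_deriv Z = U * (e * \<mu> * s + h * (fps_const k * ap * a) * r)"
      unfolding dZ by simp
    have "fps_X * (a * b * fps_deriv Z) = e * (\<mu> * (fps_X * s * U) + h * cover * Z)"
      unfolding dZ' unfolding Z_def using W(1) by algebra
    also have "\<dots> = e * (\<mu> * Y - (\<mu> - h * cover) * Z)"
      using ZY by algebra
    finally have *: "fps_X * (a * b * fps_deriv Z) = e * (\<mu> * Y - (\<mu> - h * cover) * Z)" .
    have "e ^ 4 * (cover * (1 - cover) * fps_deriv Z) = (fps_const k * ap * bn) * (fps_X * (a * b * fps_deriv Z))"
      using W(1,2) by algebra
    also have "\<dots> = e ^ 4 * (fps_deriv cover * (\<mu> * Y - (\<mu> - h * cover) * Z))"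
      unfolding * W(3)[symmetric] by algebra
    finally have "cover * (1 - cover) * fps_deriv Z = fps_deriv cover * (\<mu> * Y - (\<mu> - h * cover) * Z)"
      using nz by simp
    thus "cover * (1 - cover) * fps_deriv Z = fps_deriv cover *
       (fps_const (lam + 1 / 2 - \<gamma> / 2 - 1) * Y - (fps_const (lam + 1 / 2 - \<gamma> / 2 - 1) - fps_const (\<gamma>/2 + 1/2) * cover) * Z)"
      unfolding \<mu>_def h_def by (simp add: algebra_simps)
  qed
  thus ?thesis by (simp add: Y_def a_def b_def e_def)
qed

section \<open>Series that a Schwarz map uniformizes\<close>

text \<open>
  The pullback of \<open>f\<close> is \<open>E^g\<close> times a rational function of \<open>s\<close> without pole at \<open>0\<close>.  Keeping \<open>g\<close>
  fixed loses nothing when \<open>\<gamma>\<close> moves by integers, since integral powers of \<open>E\<close> are rational.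
\<close>
definition uniformized :: "complex \<Rightarrow> complex fps \<Rightarrow> bool" where
  "uniformized g f \<longleftrightarrow> (\<exists>v p. coeff v 0 \<noteq> 0 \<and>
     fps_of_poly v * (f oo cover) = fps_cpow (fps_of_poly E) g * fps_of_poly p)"

lemma uniformized_add:
  assumes "uniformized g f1" "uniformized g f2"
  shows "uniformized g (f1 + f2)"
proof -
  obtain v1 p1 v2 p2 where v: "coeff v1 0 \<noteq> 0" "coeff v2 0 \<noteq> 0" and
    p: "fps_of_poly v1 * (f1 oo cover) = fps_cpow (fps_of_poly E) g * fps_of_poly p1"
       "fps_of_poly v2 * (f2 oo cover) = fps_cpow (fps_of_poly E) g * fps_of_poly p2"
    using assms unfolding uniformized_def by blast
  have "fps_of_poly (v1 * v2) * ((f1 + f2) oo cover) = fps_cpow (fps_of_poly E) g * fps_of_poly (p1 * v2 + p2 * v1)"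
    using p unfolding fps_of_poly_hom fps_compose_add_distrib by algebra
  thus ?thesis using v unfolding uniformized_def by (intro exI[of _ "v1 * v2"] exI) (auto simp: coeff_mult)
qed

lemma uniformized_const_mult:
  assumes "uniformized g f" shows "uniformized g (fps_const c * f)"
proof -
  obtain v p where v: "coeff v 0 \<noteq> 0" and
    p: "fps_of_poly v * (f oo cover) = fps_cpow (fps_of_poly E) g * fps_of_poly p"
    using assms unfolding uniformized_def by blast
  have "fps_of_poly v * ((fps_const c * f) oo cover) = fps_cpow (fps_of_poly E) g * fps_of_poly (smult c p)"
    using p unfolding fps_of_poly_hom fps_compose_mult_distrib[OF cover_nth_0] by (simp add: mult.left_commute)
  thus ?thesis using v unfolding uniformized_def by blast
qed

lemma uniformized_const_mult_cancel:
  assumes "uniformized g (fps_const c * f)" "c \<noteq> 0" shows "uniformized g f"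
  using uniformized_const_mult[OF assms(1), of "1 / c"] assms(2)
  by (simp add: mult.assoc[symmetric])

lemma uniformized_diff:
  assumes "uniformized g f1" "uniformized g f2"
  shows "uniformized g (f1 - f2)"
  using uniformized_add[OF assms(1) uniformized_const_mult[OF assms(2), of "- 1"]]
  by (simp flip: fps_const_neg)

lemma uniformized_X_mult:
  assumes "uniformized g f" shows "uniformized g (fps_X * f)"
proof -
  obtain v p where v: "coeff v 0 \<noteq> 0" and
    p: "fps_of_poly v * (f oo cover) = fps_cpow (fps_of_poly E) g * fps_of_poly p"
    using assms unfolding uniformized_def by blast
  define q where "q = smult k ([:0, 1:] * A ^ Suc m)"
  have q: "cover * fps_of_poly E ^ 2 = fps_of_poly q"
    unfolding cover_E q_def fps_of_poly_hom by (simp add: mult_ac)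
  have "fps_of_poly (v * E ^ 2) * ((fps_X * f) oo cover) = fps_cpow (fps_of_poly E) g * fps_of_poly (q * p)"
    using p q unfolding fps_of_poly_hom fps_compose_mult_distrib[OF cover_nth_0]
      fps_X_fps_compose_startby0[OF cover_nth_0] by algebra
  moreover have "coeff (v * E ^ 2) 0 \<noteq> 0" using v E0 by (simp add: coeff_mult power2_eq_square)
  ultimately show ?thesis unfolding uniformized_def by blast
qed

text \<open>
  The derivative of \<open>f\<close> pulls back to the derivative of the pullback divided by that of the map; the
  latter is rational and does not vanish at \<open>0\<close>.
\<close>
lemma uniformized_deriv:
  assumes "uniformized g f" shows "uniformized g (fps_deriv f)"
proof -
  obtain v p where v: "coeff v 0 \<noteq> 0" and
    p: "fps_of_poly v * (f oo cover) = fps_cpow (fps_of_poly E) g * fps_of_poly p"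
    using assms unfolding uniformized_def by blast
  define e V P h C where "e = fps_of_poly E" and "V = fps_of_poly v" and "P = fps_of_poly p"
    and "h = f oo cover" and "C = fps_cpow e g"
  define d where "d = smult k (A ^ m * B ^ n)"
  define q where "q = smult g (pderiv E * p * v) + E * pderiv p * v - E * pderiv v * p"
  have d: "fps_deriv cover * e ^ 3 = fps_of_poly d"
    using cover_deriv_E by (simp add: d_def fps_of_poly_hom e_def mult_ac)
  have hd: "fps_deriv h = (fps_deriv f oo cover) * fps_deriv cover"
    unfolding h_def by (rule fps_compose_deriv[OF cover_nth_0])
  have Cd: "e * fps_deriv C = fps_const g * fps_deriv e * C"
    unfolding C_def by (rule fps_cpow_deriv) (simp add: e_def E0)
  have Vh: "V * h = C * P" using p by (simp add: V_def h_def C_def e_def P_def)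
  hence "fps_deriv (V * h) = fps_deriv (C * P)" by simp
  hence dVh: "fps_deriv V * h + V * fps_deriv h = fps_deriv C * P + C * fps_deriv P"
    by (simp add: algebra_simps)
  have q: "fps_of_poly q = fps_const g * (fps_deriv e * P * V) + e * fps_deriv P * V - e * fps_deriv V * P"
    by (simp add: q_def fps_of_poly_hom e_def V_def P_def)
  have "V ^ 2 * e * fps_deriv h = C * fps_of_poly q"
    unfolding q using Vh dVh Cd by algebra
  hence "V ^ 2 * e * fps_of_poly d * (fps_deriv f oo cover) = C * (e ^ 3 * fps_of_poly q)"
    unfolding d[symmetric] hd by algebra
  hence "fps_of_poly (v ^ 2 * E * d) * (fps_deriv f oo cover) = fps_cpow (fps_of_poly E) g * fps_of_poly (E ^ 3 * q)"
    by (simp add: fps_of_poly_hom V_def e_def C_def)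
  moreover have "coeff (v ^ 2 * E * d) 0 \<noteq> 0"
    using v by (simp add: d_def coeff_0_power coeff_mult A0 B0 E0 k)
  ultimately show ?thesis unfolding uniformized_def by blast
qed

definition half_hypergeo :: "complex \<Rightarrow> complex \<Rightarrow> complex fps" where
  "half_hypergeo \<gamma> lam = hypergeo (\<gamma>/2) (\<gamma>/2 + 1/2) (lam + 1/2)"

text \<open>
  Raising \<open>\<gamma>\<close> by 1 replaces the upper parameters \<open>(a, b) = (\<gamma>/2, \<gamma>/2 + 1/2)\<close> by \<open>(b, a + 1)\<close>, and lowering
  it replaces them by \<open>(b - 1, a)\<close>, so every step shifts a single parameter.  The assumptions keep the
  constants \<open>a\<close>, \<open>c - a\<close>, \<open>c - b\<close>, \<open>c\<close> and \<open>c - 1\<close> of the contiguity relations away from zero.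
\<close>
lemma uniformized_shift_1:
  assumes u: "uniformized g (half_hypergeo \<gamma> lam)" and \<gamma>: "\<gamma> \<notin> \<int>" and lam: "2 * lam \<notin> \<int>" and l\<gamma>: "2 * lam - \<gamma> \<notin> \<int>"
  shows "uniformized g (half_hypergeo (\<gamma> + 1) lam)" "uniformized g (half_hypergeo (\<gamma> - 1) lam)"
    "uniformized g (half_hypergeo \<gamma> (lam + 1))" "uniformized g (half_hypergeo \<gamma> (lam - 1))"
proof -
  define a b c where "a = \<gamma>/2" and "b = \<gamma>/2 + 1/2" and "c = lam + 1/2"
  have c: "c \<notin> \<int>" unfolding c_def using lam by (rule nonint_half)
  have c1: "c - 1 \<noteq> 0" using c Ints_1 by auto
  have a: "a \<noteq> 0" using \<gamma> by (auto simp: a_def)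
  have ca: "c - a \<noteq> 0" "c - b \<noteq> 0"
  proof -
    have "2 * (c - a) = (2 * lam - \<gamma>) + 1" "2 * (c - b) = 2 * lam - \<gamma>"
      by (simp_all add: a_def b_def c_def)
    moreover have "2 * lam - \<gamma> + 1 \<noteq> 0" "2 * lam - \<gamma> \<noteq> 0"
      using nonint_add_nat[OF l\<gamma>, of 1] nonint_add_nat[OF l\<gamma>, of 0] by auto
    ultimately show "c - a \<noteq> 0" "c - b \<noteq> 0" by force+
  qed
  have F: "uniformized g (hypergeo a b c)" using u by (simp add: half_hypergeo_def a_def b_def c_def)
  have F': "uniformized g (hypergeo b a c)" using F by (simp add: hypergeo_commute)
  note U = uniformized_add uniformized_diff uniformized_const_mult uniformized_X_mult uniformized_deriv
  have "uniformized g (fps_const a * hypergeo (a + 1) b c)"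
    unfolding hypergeo_raise[symmetric] by (intro U F)
  hence "uniformized g (hypergeo (a + 1) b c)" using a by (rule uniformized_const_mult_cancel)
  moreover have "half_hypergeo (\<gamma> + 1) lam = hypergeo (a + 1) b c"
    unfolding half_hypergeo_def a_def b_def c_def by (subst hypergeo_commute) (simp add: add_divide_distrib add.commute)
  ultimately show "uniformized g (half_hypergeo (\<gamma> + 1) lam)" by simp
  have "fps_X * (fps_deriv (hypergeo b a c) - fps_X * fps_deriv (hypergeo b a c)) +
     (fps_const (c - b) * hypergeo b a c - fps_const a * (fps_X * hypergeo b a c))
    = fps_const (c - b) * hypergeo (b - 1) a c"
    unfolding hypergeo_lower[OF c, symmetric] by (simp add: algebra_simps)
  moreover have "uniformized g (fps_X * (fps_deriv (hypergeo b a c) - fps_X * fps_deriv (hypergeo b a c)) +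
     (fps_const (c - b) * hypergeo b a c - fps_const a * (fps_X * hypergeo b a c)))"
    by (intro U F')
  ultimately have "uniformized g (hypergeo (b - 1) a c)"
    using uniformized_const_mult_cancel ca by metis
  moreover have "half_hypergeo (\<gamma> - 1) lam = hypergeo (b - 1) a c"
    unfolding half_hypergeo_def a_def b_def c_def by (simp add: diff_divide_distrib)
  ultimately show "uniformized g (half_hypergeo (\<gamma> - 1) lam)" by simp
  have "(fps_deriv (hypergeo a b c) - fps_X * fps_deriv (hypergeo a b c)) + fps_const (c - a - b) * hypergeo a b c
      = fps_const ((c - a) * (c - b) / c) * hypergeo a b (c + 1)"
    unfolding hypergeo_raise_c[OF c, symmetric] by (simp add: algebra_simps)
  moreover have "uniformized g ((fps_deriv (hypergeo a b c) - fps_X * fps_deriv (hypergeo a b c))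
      + fps_const (c - a - b) * hypergeo a b c)"
    by (intro U F)
  moreover have "(c - a) * (c - b) / c \<noteq> 0" using ca c by auto
  ultimately have "uniformized g (hypergeo a b (c + 1))"
    using uniformized_const_mult_cancel by metis
  moreover have "half_hypergeo \<gamma> (lam + 1) = hypergeo a b (c + 1)"
    unfolding half_hypergeo_def a_def b_def c_def by (simp add: algebra_simps)
  ultimately show "uniformized g (half_hypergeo \<gamma> (lam + 1))" by simp
  have "uniformized g (fps_const (c - 1) * hypergeo a b (c - 1))"
    unfolding hypergeo_lower_c[OF c, symmetric] by (intro U F)
  hence "uniformized g (hypergeo a b (c - 1))" using c1 by (rule uniformized_const_mult_cancel)
  moreover have "half_hypergeo \<gamma> (lam - 1) = hypergeo a b (c - 1)"
    unfolding half_hypergeo_def a_def b_def c_def by (simp add: algebra_simps)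
  ultimately show "uniformized g (half_hypergeo \<gamma> (lam - 1))" by simp
qed

lemma uniformized_shift:
  assumes u: "uniformized g (half_hypergeo \<gamma> lam)" and \<gamma>: "\<gamma> \<notin> \<int>" and lam: "2 * lam \<notin> \<int>" and l\<gamma>: "2 * lam - \<gamma> \<notin> \<int>"
  shows "uniformized g (half_hypergeo (\<gamma> + of_int i) (lam + of_int j))"
proof -
  have 1: "uniformized g (half_hypergeo (\<gamma> + of_int i) lam)"
  proof (induction i rule: int_induct[of _ 0])
    case base
    show ?case using u by simp
  next
    case (step1 i)
    have "2 * lam - (\<gamma> + of_int i) \<notin> \<int>"
      using l\<gamma> Ints_add[of "2 * lam - (\<gamma> + of_int i)" "of_int i"] by auto
    thus ?case using uniformized_shift_1(1)[OF step1(2) _ lam] \<gamma> by (simp add: add.assoc)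
  next
    case (step2 i)
    have "2 * lam - (\<gamma> + of_int i) \<notin> \<int>"
      using l\<gamma> Ints_add[of "2 * lam - (\<gamma> + of_int i)" "of_int i"] by auto
    thus ?case using uniformized_shift_1(2)[OF step2(2) _ lam] \<gamma> by (simp add: algebra_simps)
  qed
  have \<gamma>': "\<gamma> + of_int i \<notin> \<int>" using \<gamma> by simp
  have n: "2 * (lam + of_int j) \<notin> \<int>" "2 * (lam + of_int j) - (\<gamma> + of_int i) \<notin> \<int>" for j
  proof -
    have "2 * (lam + of_int j) = 2 * lam + of_int (2 * j)"
       "2 * (lam + of_int j) - (\<gamma> + of_int i) = (2 * lam - \<gamma>) + of_int (2 * j - i)" by simp_all
    moreover have "z + of_int r \<notin> \<int>" if "z \<notin> \<int>" for z :: complex and r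
      using that by simp
    ultimately show "2 * (lam + of_int j) \<notin> \<int>" "2 * (lam + of_int j) - (\<gamma> + of_int i) \<notin> \<int>"
      using lam l\<gamma> by metis+
  qed
  show ?thesis
  proof (induction j rule: int_induct[of _ 0])
    case base
    show ?case using 1 by simp
  next
    case (step1 j)
    show ?case using uniformized_shift_1(3)[OF step1(2) \<gamma>' n] by (simp add: add.assoc)
  next
    case (step2 j)
    show ?case using uniformized_shift_1(4)[OF step2(2) \<gamma>' n] by (simp add: algebra_simps)
  qed
qed

section \<open>Algebraicity\<close>

text \<open>
  The series \<open>s\<close> in \<open>t\<close>, obtained from \<open>\<zeta>\<close> by the compositional inverse of the map, is a root of \<open>BB\<close>,
  which is \<open>map(s) = \<zeta>\<close> cleared of denominators.  The number \<open>N\<close> makes \<open>(1 - x t)^(-N \<gamma>)\<close> and \<open>E^(N g)\<close>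
  integral powers; splitting their exponents into positive and negative part gives the polynomials \<open>CC\<close>
  and \<open>AA\<close> with \<open>AA(s) F^N = CC(s)\<close>.
\<close>
lemma uniformized_imp_algebraic:
  assumes u: "uniformized g (half_hypergeo \<gamma> lam)" and N: "N > 0" "of_nat N * g \<in> \<int>" and i: "\<gamma> - g \<in> \<int>"
    and \<gamma>: "\<gamma> \<notin> \<int>" and lam: "2 * lam \<notin> \<int>"
  shows "defines_algebraic_function (gegenbauer_gf \<gamma> lam)"
proof -
  obtain v p where v: "coeff v 0 \<noteq> 0" and
    p: "fps_of_poly v * (half_hypergeo \<gamma> lam oo cover) = fps_cpow (fps_of_poly E) g * fps_of_poly p"
    using u unfolding uniformized_def by blast
  obtain j where j: "of_nat N * g = of_int j" using N by (auto elim: Ints_cases)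
  have "of_nat N * \<gamma> = of_nat N * (\<gamma> - g) + of_nat N * g" by (simp add: algebra_simps)
  hence "- (of_nat N * \<gamma>) \<in> \<int>" using N i by (metis Ints_add Ints_minus Ints_mult Ints_of_nat)
  then obtain i where i: "- (of_nat N * \<gamma>) = of_int i" by (metis Ints_cases)
  define lift where "lift = map_poly (\<lambda>c::complex. [:[:c:]:])"
  define l :: "complex poly poly" where "l = [:1, [:0, - 1:]:]"
  define z :: "complex poly poly" where "z = [:0, 0, [:- 1, 0, 1:]:]"
  define q where "q = smult k ([:0, 1:] * A ^ Suc m)"
  define BB where "BB = smult (l ^ 2) (lift q) - smult z (lift (E ^ 2))"
  define AA where "AA = smult (l ^ nat (- i)) (lift (v ^ N * E ^ nat (- j)))"
  define CC where "CC = smult (l ^ nat i) (lift (E ^ nat j * p ^ N))"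
  \<comment> \<open>For \<open>x = 1\<close> and \<open>x = -1\<close> this coefficient vanishes, but not as a polynomial in \<open>x\<close> and \<open>t\<close>.\<close>
  have "coeff BB 0 = - z"
    unfolding BB_def lift_def by (simp add: coeff_map_poly q_def coeff_0_power E0 flip: one_pCons)
  hence BB: "BB \<noteq> 0" by (auto simp: z_def)
  obtain P where P: "P \<noteq> 0"
    "\<And>(\<phi> :: _ \<Rightarrow> complex fps) s y. ring_morphism \<phi> \<Longrightarrow> poly (map_poly \<phi> BB) s = 0 \<Longrightarrow>
       poly (map_poly \<phi> AA) s * y ^ N = poly (map_poly \<phi> CC) s \<Longrightarrow> poly (map_poly \<phi> AA) s \<noteq> 0 \<Longrightarrow>
       poly (map_poly \<phi> P) y = 0"
    using elimination[OF BB N(1), of AA CC] by metis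
  show ?thesis
  proof (rule defines_algebraic_functionI[OF fps_conv_radius_gegenbauer_gf[OF lam \<gamma>] P(1)])
    fix x :: complex
    note M = ring_morphism_specialize[of x]
    define L where "L = 1 - fps_const x * fps_X"
    define s where "s = fps_inv cover oo gegenbauer_arg x"
    have s0: "s $ 0 = 0" by (simp add: s_def fps_inv_def)
    have i0: "fps_inv cover $ 0 = 0" by (simp add: fps_inv_def)
    note comp = fps_compose_mult_distrib[OF s0] fps_compose_power[OF s0, symmetric]
    have ws: "cover oo s = gegenbauer_arg x"
      unfolding s_def
      by (simp add: fps_compose_assoc[OF gegenbauer_arg_nth_0 i0] fps_inv_right[OF cover_nth_0 cover_nth_1]
          fps_X_fps_compose_startby0)
    have l: "specialize x l = L"
      by (simp add: l_def L_def specialize_pCons ring_morphism_simps[OF M] specialize_def[of x 0] flip: fps_const_neg)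
    have z: "specialize x z = fps_const (x\<^sup>2 - 1) * fps_X\<^sup>2"
      by (simp add: z_def specialize_pCons ring_morphism_simps[OF M] power2_eq_square mult_ac)
    have lift: "poly (map_poly (specialize x) (lift q)) s = fps_of_poly q oo s" for q
      unfolding lift_def by (rule poly_map_poly_lift[OF s0])
    note ev = ring_morphism_simps[OF ring_morphism_poly[OF M]] poly_map_poly_smult[OF M]
        ring_morphism_simps(5)[OF M] l z lift
    define e V Pp h C where "e = fps_of_poly E oo s" and "V = fps_of_poly v oo s" and "Pp = fps_of_poly p oo s"
      and "h = half_hypergeo \<gamma> lam oo gegenbauer_arg x" and "C = fps_cpow e g"
    have e0: "e $ 0 = 1" by (simp add: e_def E0)
    have L0: "L $ 0 = 1" by (simp add: L_def)
    have "fps_of_poly q = cover * fps_of_poly E ^ 2"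
      unfolding cover_E q_def fps_of_poly_hom by (simp add: mult_ac)
    hence "L ^ 2 * (fps_of_poly q oo s) = (L ^ 2 * gegenbauer_arg x) * e ^ 2"
      by (simp add: comp ws e_def mult_ac)
    hence "poly (map_poly (specialize x) BB) s = 0"
      unfolding BB_def by (simp add: ev fps_of_poly_power comp gegenbauer_arg_mult[of x, folded L_def] e_def[symmetric])
    moreover have "poly (map_poly (specialize x) AA) s * gegenbauer_gf \<gamma> lam x ^ N = poly (map_poly (specialize x) CC) s"
    proof -
      have h: "V * h = C * Pp"
        using arg_cong[OF p, of "\<lambda>f. f oo s"]
        by (simp add: comp fps_compose_assoc[OF s0 cover_nth_0, symmetric] ws V_def h_def C_def e_def Pp_def
            fps_cpow_compose[OF _ s0] E0)
      have F: "gegenbauer_gf \<gamma> lam x = fps_cpow L (- \<gamma>) * h"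
        using gegenbauer_gf_eq[OF lam] by (simp add: L_def h_def half_hypergeo_def)
      have LN: "fps_cpow L (- \<gamma>) ^ N * L ^ nat (- i) = L ^ nat i"
        using fps_cpow_of_int[OF L0, of i] i by (simp add: fps_cpow_power[OF L0])
      have CN: "C ^ N * e ^ nat (- j) = e ^ nat j"
        using fps_cpow_of_int[OF e0, of j] j by (simp add: fps_cpow_power[OF e0] C_def)
      have "L ^ nat (- i) * (V ^ N * e ^ nat (- j)) * gegenbauer_gf \<gamma> lam x ^ N =
          (fps_cpow L (- \<gamma>) ^ N * L ^ nat (- i)) * ((V * h) ^ N * e ^ nat (- j))"
        unfolding F by (simp add: power_mult_distrib mult_ac)
      also have "\<dots> = L ^ nat i * ((C ^ N * e ^ nat (- j)) * Pp ^ N)"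
        unfolding LN h by (simp add: power_mult_distrib mult_ac)
      also have "\<dots> = L ^ nat i * (e ^ nat j * Pp ^ N)" unfolding CN ..
      finally show ?thesis unfolding AA_def CC_def
        by (simp add: ev fps_of_poly_power fps_of_poly_mult comp e_def V_def Pp_def)
    qed
    moreover have "poly (map_poly (specialize x) AA) s \<noteq> 0"
    proof -
      have "L \<noteq> 0" "e \<noteq> 0" using L0 e0 by auto
      moreover have "V $ 0 \<noteq> 0" using v by (simp add: V_def)
      hence "V \<noteq> 0" by auto
      ultimately show ?thesis unfolding AA_def
        by (simp add: ev fps_of_poly_power fps_of_poly_mult comp e_def V_def)
    qed
    ultimately show "poly (map_poly (specialize x) P) (gegenbauer_gf \<gamma> lam x) = 0"
      by (rule P(2)[OF M])
  qed
qed

lemma uniformized_if_certificate: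
  assumes "certificate m n A B E \<gamma> lam \<alpha> \<beta>" "2 * lam \<notin> \<int>" "\<gamma> \<notin> \<int>"
  shows "uniformized \<gamma> (half_hypergeo \<gamma> lam)"
proof -
  let ?a = "fps_of_poly A" and ?b = "fps_of_poly B"
  have "?a * inverse ?a = 1" "?b * inverse ?b = 1"
    by (simp_all add: inverse_mult_eq_1' A0 B0)
  hence inv: "?a ^ \<alpha> * inverse ?a ^ \<alpha> = 1" "?b ^ \<beta> * inverse ?b ^ \<beta> = 1"
    by (simp_all flip: power_mult_distrib)
  have "\<gamma> \<noteq> 0" using assms(3) by auto
  from hypergeo_along_cover[OF assms(1) nonint_half[OF assms(2)] this]
  have "fps_of_poly (A ^ \<alpha> * B ^ \<beta>) * (half_hypergeo \<gamma> lam oo cover) =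
      (?a ^ \<alpha> * inverse ?a ^ \<alpha>) * (?b ^ \<beta> * inverse ?b ^ \<beta>) * fps_cpow (fps_of_poly E) \<gamma>"
    by (simp add: half_hypergeo_def fps_of_poly_hom mult_ac)
  hence "fps_of_poly (A ^ \<alpha> * B ^ \<beta>) * (half_hypergeo \<gamma> lam oo cover) = fps_cpow (fps_of_poly E) \<gamma> * fps_of_poly 1"
    unfolding inv by simp
  moreover have "coeff (A ^ \<alpha> * B ^ \<beta>) 0 \<noteq> 0"
    by (simp add: coeff_mult coeff_0_power A0 B0)
  ultimately show ?thesis unfolding uniformized_def by blast
qed

text \<open>
  The representative parameters of the three cases are multiples of \<open>1/12\<close>, which makes the conditions of
  \<open>uniformized_shift\<close> decidable by divisibility.
\<close>
lemma algebraic_if_certificate: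
  assumes cert: "certificate m n A B E \<gamma>\<^sub>0 lam\<^sub>0 \<alpha> \<beta>"
    and p: "12 * \<gamma>\<^sub>0 = of_int p" and r: "12 * lam\<^sub>0 = of_int r"
    and nd: "\<not> 12 dvd p" "\<not> 12 dvd 2 * r" "\<not> 12 dvd 2 * r - p"
    and shift: "\<gamma> - \<gamma>\<^sub>0 \<in> \<int>" "lam - lam\<^sub>0 \<in> \<int>"
  shows "defines_algebraic_function (gegenbauer_gf \<gamma> lam)"
proof -
  have nonint: "z \<notin> \<int>" if "12 * z = of_int q" "\<not> 12 dvd q" for z :: complex and q
  proof
    assume "z \<in> \<int>"
    then obtain i where "z = of_int i" by (auto elim: Ints_cases)
    hence "of_int (12 * i) = (of_int q :: complex)" using that(1) by simp
    hence "q = 12 * i" by (simp only: of_int_eq_iff)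
    thus False using that(2) by simp
  qed
  have n0: "\<gamma>\<^sub>0 \<notin> \<int>" "2 * lam\<^sub>0 \<notin> \<int>" "2 * lam\<^sub>0 - \<gamma>\<^sub>0 \<notin> \<int>"
    by (rule nonint[OF _ nd(1)] nonint[OF _ nd(2)] nonint[OF _ nd(3)]; simp add: p r right_diff_distrib)+
  obtain i j where ij: "\<gamma> = \<gamma>\<^sub>0 + of_int i" "lam = lam\<^sub>0 + of_int j"
    using shift by (metis Ints_cases add_diff_cancel_left' diff_add_cancel add.commute)
  have "uniformized \<gamma>\<^sub>0 (half_hypergeo \<gamma> lam)"
    unfolding ij by (intro uniformized_shift uniformized_if_certificate[OF cert] n0)
  moreover have "\<gamma> \<notin> \<int>" using n0(1) ij by simp
  moreover have "2 * lam \<notin> \<int>"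
  proof -
    have "2 * lam = 2 * lam\<^sub>0 + of_int (2 * j)" by (simp add: ij)
    thus ?thesis using n0(2) by (metis Ints_diff Ints_of_int add_diff_cancel_right')
  qed
  moreover have "of_nat 12 * \<gamma>\<^sub>0 \<in> \<int>" using p by simp
  ultimately show ?thesis
    using uniformized_imp_algebraic[of "\<gamma>\<^sub>0" \<gamma> lam 12] shift by simp
qed

text \<open>
  Modulo integers, \<open>\<lambda>\<close> is \<open>u\<close> or \<open>1 - u\<close> and \<open>\<gamma>\<close> is \<open>\<lambda> - d\<close> or \<open>\<lambda> + d\<close>.  The value of \<open>\<lambda>\<close> decides which of the two
  exponents at \<open>0\<close> belongs to the power series solution, hence whether a factor \<open>1/A\<close> occurs; in the
  same way \<open>\<gamma>\<close> decides about the factor \<open>1/B\<close>.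
\<close>
lemma algebraic_if_certs:
  assumes cert: "certificate m n A B E (u - d) u 0 0" "certificate m n A B E (u + d) u 0 1"
      "certificate m n A B E (1 - u - d) (1 - u) 1 0" "certificate m n A B E (1 - u + d) (1 - u) 1 1"
    and u: "12 * u = of_int r" and d: "12 * d = of_int q"
    and nd: "\<not> 12 dvd 2 * r" "\<not> 12 dvd r + q" "\<not> 12 dvd r - q"
    and lam: "lam \<in> Ints_pm u" and \<gamma>: "\<gamma> - lam \<in> Ints_pm d"
  shows "defines_algebraic_function (gegenbauer_gf \<gamma> lam)"
proof -
  have pm: "z - a \<in> \<int> \<or> z + a \<in> \<int>" if "z \<in> Ints_pm a" for z a
    using that by (auto simp: Ints_pm_def)
  have nd': "\<not> 12 dvd q - r" "\<not> 12 dvd - r - q" "\<not> 12 dvd 2 * (12 - r)" "\<not> 12 dvd 12 - r + q" "\<not> 12 dvd 12 - r - q"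
    using nd by presburger+
  have l: "lam - (1 - u) \<in> \<int>" if "lam + u \<in> \<int>"
    using Ints_diff[OF that Ints_1] by (simp add: algebra_simps)
  have g: "\<gamma> - (lam' + d) \<in> \<int>" if "\<gamma> - lam - d \<in> \<int>" "lam - lam' \<in> \<int>" for lam'
    using Ints_add[OF that] by (simp add: algebra_simps)
  have g': "\<gamma> - (lam' - d) \<in> \<int>" if "\<gamma> - lam + d \<in> \<int>" "lam - lam' \<in> \<int>" for lam'
    using Ints_add[OF that] by (simp add: algebra_simps)
  from pm[OF lam] show ?thesis
  proof
    assume l0: "lam - u \<in> \<int>"
    from pm[OF \<gamma>] show ?thesis
    proof
      assume "\<gamma> - lam - d \<in> \<int>"
      note shift = g[OF this l0]
      show ?thesis
        by (rule algebraic_if_certificate[OF cert(2), of "r + q" r])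
           (use shift u d nd nd' l0 in \<open>auto simp: distrib_left\<close>)
    next
      assume "\<gamma> - lam + d \<in> \<int>"
      note shift = g'[OF this l0]
      show ?thesis
        by (rule algebraic_if_certificate[OF cert(1), of "r - q" r])
           (use shift u d nd nd' l0 in \<open>auto simp: right_diff_distrib\<close>)
    qed
  next
    assume "lam + u \<in> \<int>"
    hence l1: "lam - (1 - u) \<in> \<int>" by (rule l)
    from pm[OF \<gamma>] show ?thesis
    proof
      assume "\<gamma> - lam - d \<in> \<int>"
      note shift = g[OF this l1]
      show ?thesis
        by (rule algebraic_if_certificate[OF cert(4), of "12 - r + q" "12 - r"])
           (use shift u d nd nd' l1 in \<open>auto simp: right_diff_distrib distrib_left\<close>)
    next
      assume "\<gamma> - lam + d \<in> \<int>"
      note shift = g'[OF this l1]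
      show ?thesis
        by (rule algebraic_if_certificate[OF cert(3), of "12 - r - q" "12 - r"])
           (use shift u d nd nd' l1 in \<open>auto simp: right_diff_distrib\<close>)
    qed
  qed
qed

end

section \<open>The tetrahedral and octahedral cases\<close>

text \<open>
  The octahedron with a vertex at the origin and the opposite one at infinity: \<open>A\<close> belongs to the
  other vertices, \<open>B\<close> to the centres of the faces, \<open>E\<close> to the midpoints of the edges.  Here and below the
  coordinate is scaled so that the coefficients are integers and the constant terms are 1.
\<close>
lemma octahedral_quarter_third: "schwarz_map (-108) 3 2 [:1, -1:] [:1, 14, 1:] [:1, -33, -33, 1:]"
  by unfold_locales (simp_all add: pderiv_pCons eval_nat_numeral)

lemma octahedral_quarter_third_certs:
  "certificate 3 2 [:1, -1:] [:1, 14, 1:] [:1, -33, -33, 1:] (1/4 - 1/3) (1/4) 0 0"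
  "certificate 3 2 [:1, -1:] [:1, 14, 1:] [:1, -33, -33, 1:] (1/4 + 1/3) (1/4) 0 1"
  "certificate 3 2 [:1, -1:] [:1, 14, 1:] [:1, -33, -33, 1:] (1 - 1/4 - 1/3) (1 - 1/4) 1 0"
  "certificate 3 2 [:1, -1:] [:1, 14, 1:] [:1, -33, -33, 1:] (1 - 1/4 + 1/3) (1 - 1/4) 1 1"
  by (simp_all add: certificate_def raised_numerator_def log_deriv_numerator_def pderiv_pCons)

text \<open>
  The tetrahedron with a vertex at the origin: \<open>A\<close> belongs to the other vertices, \<open>B\<close> to the centres
  of the faces, one of which lies at infinity, and \<open>E\<close> to the midpoints of the edges.
\<close>
lemma tetrahedral_third_third: "schwarz_map 64 2 2 [:1, 1:] [:1, -8:] [:1, 20, -8:]"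
  by unfold_locales (simp_all add: pderiv_pCons eval_nat_numeral)

lemma tetrahedral_third_third_certs:
  "certificate 2 2 [:1, 1:] [:1, -8:] [:1, 20, -8:] (1/6 - 1/3) (1/6) 0 0"
  "certificate 2 2 [:1, 1:] [:1, -8:] [:1, 20, -8:] (1/6 + 1/3) (1/6) 0 1"
  "certificate 2 2 [:1, 1:] [:1, -8:] [:1, 20, -8:] (1 - 1/6 - 1/3) (1 - 1/6) 1 0"
  "certificate 2 2 [:1, 1:] [:1, -8:] [:1, 20, -8:] (1 - 1/6 + 1/3) (1 - 1/6) 1 1"
  by (simp_all add: certificate_def raised_numerator_def log_deriv_numerator_def pderiv_pCons)

text \<open>
  The octahedron with the centre of a face at the origin: \<open>A\<close> belongs to the centres of the
  other faces except the opposite one, which lies at infinity, \<open>B\<close> to the vertices, \<open>E\<close> to the midpoints of the edges.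
\<close>
lemma octahedral_third_quarter:
  "schwarz_map (-256) 2 3 [:1, -7, -8:] [:1, 20, -8:] [:1, -88, 0, -704, -64:]"
  by unfold_locales (simp_all add: pderiv_pCons eval_nat_numeral)

lemma octahedral_third_quarter_certs:
  "certificate 2 3 [:1, -7, -8:] [:1, 20, -8:] [:1, -88, 0, -704, -64:] (1/6 - 1/4) (1/6) 0 0"
  "certificate 2 3 [:1, -7, -8:] [:1, 20, -8:] [:1, -88, 0, -704, -64:] (1/6 + 1/4) (1/6) 0 1"
  "certificate 2 3 [:1, -7, -8:] [:1, 20, -8:] [:1, -88, 0, -704, -64:] (1 - 1/6 - 1/4) (1 - 1/6) 1 0"
  "certificate 2 3 [:1, -7, -8:] [:1, 20, -8:] [:1, -88, 0, -704, -64:] (1 - 1/6 + 1/4) (1 - 1/6) 1 1"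
  by (simp_all add: certificate_def raised_numerator_def log_deriv_numerator_def pderiv_pCons)

theorem theorem1p4:
  fixes lam \<gamma> :: complex
  assumes "(lam \<in> Ints_pm (1/4) \<and> \<gamma> - lam \<in> Ints_pm (1/3)) \<or>
           (lam \<in> Ints_pm (1/6) \<and> \<gamma> - lam \<in> Ints_pm (1/3) \<union> Ints_pm (1/4))"
  shows "defines_algebraic_function (gegenbauer_gf \<gamma> lam)"
proof -
  consider "lam \<in> Ints_pm (1/4)" "\<gamma> - lam \<in> Ints_pm (1/3)"
    | "lam \<in> Ints_pm (1/6)" "\<gamma> - lam \<in> Ints_pm (1/3)"
    | "lam \<in> Ints_pm (1/6)" "\<gamma> - lam \<in> Ints_pm (1/4)"
    using assms by blast
  thus ?thesis
  proof cases
    case 1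
    show ?thesis
      by (rule schwarz_map.algebraic_if_certs[OF octahedral_quarter_third
            octahedral_quarter_third_certs, where r = 3 and q = 4])
         (use 1 in simp_all)
  next
    case 2
    show ?thesis
      by (rule schwarz_map.algebraic_if_certs[OF tetrahedral_third_third
            tetrahedral_third_third_certs, where r = 2 and q = 4])
         (use 2 in simp_all)
  next
    case 3
    show ?thesis
      by (rule schwarz_map.algebraic_if_certs[OF octahedral_third_quarter
            octahedral_third_quarter_certs, where r = 2 and q = 3])
         (use 3 in simp_all)
  qed
qed

end
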